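(* Let $T$ be a complete continuous theory with $NIP$ and $M\models T$, and let $M_0^\Omega$ be a simple randomization of $M$. Then for every formula $\phi(x;y)$ and all $r<s$ there is a natural number $N$ such that there is no sequence $(\mu_1,\ldots,\mu_N)$ of average measures of elements of $M$ which is shattered by elements in $M_0^\Omega$ for $\phi(x;y)$ and $r<s$.
   Context: Formulas take values in $[0,1]$. For $a_1,\dots,a_k\in M$, the average measure ${\rm Ave}(a_1,\dots,a_k)$ assigns to $\phi(x;b)$ the value $\frac1k\sum_{j=1}^k\phi(a_j;b)$. For an atomless finitely additive probability space $(\Omega_0,\mathcal B_0,\mu_0)$, $M_0^\Omega$ is the set of functions $\Omega_0\to M$ with finite image and measurable fibers. A sequence $(\mu_i:i<N)$ of average measures is shattered by elements in $M_0^\Omega$ for $\phi$ and $r<s$ if for every $I\subseteq\{i:i<N\}$ there are $t\in\mathbb N$ and $b^I_1,\dots,b^I_t\in M$ with $\frac1t\sum_{j=1}^t\mu_i(\phi(x;b^I_j))\le r$ for $i\in I$ and $\ge s$ for $i\notin I$. A continuous formula has $IP$ if there are $r<s\le1$ and $(a_i:i<\omega)$ such that for each $I\subseteq\mathbb N$ some $b$ has $\phi(a_i;b)\le r$ for $i\in I$ and $\ge s$ otherwise; $NIP$ means no formula has $IP$. *)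

theory Defs
  imports "HOL-Analysis.Analysis"
begin

section \<open>Continuous first-order logic\<close>

text \<open>
  The metric-structure formalism of Ben Yaacov, Berenstein, Henson and Usvyatsov, one-sorted, with
  metrics bounded by 1 and formulas with values in the unit interval.  The moduli of uniform
  continuity are part of the signature, as functions from (0,1] to (0,1].
\<close>

record ('f, 'p) signature =
  fsyms :: "'f set"
  psyms :: "'p set"
  farity :: "'f \<Rightarrow> nat"
  parity :: "'p \<Rightarrow> nat"
  fmodulus :: "'f \<Rightarrow> real \<Rightarrow> real"
  pmodulus :: "'p \<Rightarrow> real \<Rightarrow> real"

definition wf_signature :: "('f, 'p) signature \<Rightarrow> bool" where
  "wf_signature L \<longleftrightarrow>
     (\<forall>f\<in>fsyms L. \<forall>\<epsilon>\<in>{0<..1}. fmodulus L f \<epsilon> \<in> {0<..1}) \<and>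
     (\<forall>p\<in>psyms L. \<forall>\<epsilon>\<in>{0<..1}. pmodulus L p \<epsilon> \<in> {0<..1})"

record ('f, 'p, 'm) cstructure =
  metr :: "'m metric"
  fint :: "'f \<Rightarrow> 'm list \<Rightarrow> 'm"
  pint :: "'p \<Rightarrow> 'm list \<Rightarrow> real"

definition univ :: "('f, 'p, 'm) cstructure \<Rightarrow> 'm set" where
  "univ M = mspace (metr M)"

definition tuples :: "('f, 'p, 'm) cstructure \<Rightarrow> nat \<Rightarrow> 'm list set" where
  "tuples M n = {a. length a = n \<and> set a \<subseteq> univ M}"

text \<open>Tuples are compared in the maximum metric.\<close>

definition tuples_within :: "('f, 'p, 'm) cstructure \<Rightarrow> nat \<Rightarrow> real \<Rightarrow> 'm list \<Rightarrow> 'm list \<Rightarrow> bool" where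
  "tuples_within M n \<delta> a b \<longleftrightarrow> (\<forall>i<n. mdist (metr M) (a ! i) (b ! i) < \<delta>)"

definition is_structure :: "('f, 'p) signature \<Rightarrow> ('f, 'p, 'm) cstructure \<Rightarrow> bool" where
  "is_structure L M \<longleftrightarrow>
     univ M \<noteq> {} \<and> mcomplete_of (metr M) \<and>
     (\<forall>a\<in>univ M. \<forall>b\<in>univ M. mdist (metr M) a b \<le> 1) \<and>
     (\<forall>f\<in>fsyms L. \<forall>a\<in>tuples M (farity L f). fint M f a \<in> univ M) \<and>
     (\<forall>p\<in>psyms L. \<forall>a\<in>tuples M (parity L p). pint M p a \<in> {0..1}) \<and>
     (\<forall>f\<in>fsyms L. \<forall>\<epsilon>\<in>{0<..1}. \<forall>a\<in>tuples M (farity L f). \<forall>b\<in>tuples M (farity L f).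
        tuples_within M (farity L f) (fmodulus L f \<epsilon>) a b \<longrightarrow>
        mdist (metr M) (fint M f a) (fint M f b) \<le> \<epsilon>) \<and>
     (\<forall>p\<in>psyms L. \<forall>\<epsilon>\<in>{0<..1}. \<forall>a\<in>tuples M (parity L p). \<forall>b\<in>tuples M (parity L p).
        tuples_within M (parity L p) (pmodulus L p \<epsilon>) a b \<longrightarrow>
        \<bar>pint M p a - pint M p b\<bar> \<le> \<epsilon>)"

datatype 'f cterm = TVar nat | TApp 'f "'f cterm list"

text \<open>
  The first argument of \<open>FConn\<close> is a connective; with n argument formulas it is applied to the
  n-tuple of their values, encoded as an extensional function on \<open>{..<n}\<close>.
\<close>

datatype ('f, 'p) cform =
    FDist "'f cterm" "'f cterm"
  | FPred 'p "'f cterm list"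
  | FConn "(nat \<Rightarrow> real) \<Rightarrow> real" "('f, 'p) cform list"
  | FSup nat "('f, 'p) cform"
  | FInf nat "('f, 'p) cform"

definition is_connective :: "nat \<Rightarrow> ((nat \<Rightarrow> real) \<Rightarrow> real) \<Rightarrow> bool" where
  "is_connective n u \<longleftrightarrow>
     continuous_map (product_topology (\<lambda>_. top_of_set {0..1}) {..<n}) (top_of_set {0..1}) u"

fun wf_term :: "('f, 'p) signature \<Rightarrow> 'f cterm \<Rightarrow> bool" where
  "wf_term L (TVar x) \<longleftrightarrow> True"
| "wf_term L (TApp f ts) \<longleftrightarrow> f \<in> fsyms L \<and> length ts = farity L f \<and> (\<forall>t\<in>set ts. wf_term L t)"

fun wf_form :: "('f, 'p) signature \<Rightarrow> ('f, 'p) cform \<Rightarrow> bool" where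
  "wf_form L (FDist t u) \<longleftrightarrow> wf_term L t \<and> wf_term L u"
| "wf_form L (FPred p ts) \<longleftrightarrow>
     p \<in> psyms L \<and> length ts = parity L p \<and> (\<forall>t\<in>set ts. wf_term L t)"
| "wf_form L (FConn u \<phi>s) \<longleftrightarrow> is_connective (length \<phi>s) u \<and> (\<forall>\<phi>\<in>set \<phi>s. wf_form L \<phi>)"
| "wf_form L (FSup x \<phi>) \<longleftrightarrow> wf_form L \<phi>"
| "wf_form L (FInf x \<phi>) \<longleftrightarrow> wf_form L \<phi>"

fun tvars :: "'f cterm \<Rightarrow> nat set" where
  "tvars (TVar x) = {x}"
| "tvars (TApp f ts) = (\<Union>t\<in>set ts. tvars t)"

fun free_vars :: "('f, 'p) cform \<Rightarrow> nat set" where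
  "free_vars (FDist t u) = tvars t \<union> tvars u"
| "free_vars (FPred p ts) = (\<Union>t\<in>set ts. tvars t)"
| "free_vars (FConn u \<phi>s) = (\<Union>\<phi>\<in>set \<phi>s. free_vars \<phi>)"
| "free_vars (FSup x \<phi>) = free_vars \<phi> - {x}"
| "free_vars (FInf x \<phi>) = free_vars \<phi> - {x}"

fun tval :: "('f, 'p, 'm) cstructure \<Rightarrow> (nat \<Rightarrow> 'm) \<Rightarrow> 'f cterm \<Rightarrow> 'm" where
  "tval M v (TVar x) = v x"
| "tval M v (TApp f ts) = fint M f (map (tval M v) ts)"

fun fval :: "('f, 'p, 'm) cstructure \<Rightarrow> (nat \<Rightarrow> 'm) \<Rightarrow> ('f, 'p) cform \<Rightarrow> real" where
  "fval M v (FDist t u) = mdist (metr M) (tval M v t) (tval M v u)"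
| "fval M v (FPred p ts) = pint M p (map (tval M v) ts)"
| "fval M v (FConn u \<phi>s) = u (\<lambda>i\<in>{..<length \<phi>s}. map (fval M v) \<phi>s ! i)"
| "fval M v (FSup x \<phi>) = (SUP a\<in>univ M. fval M (v(x := a)) \<phi>)"
| "fval M v (FInf x \<phi>) = (INF a\<in>univ M. fval M (v(x := a)) \<phi>)"

text \<open>
  A theory is a set of sentences; a sentence \<open>\<sigma>\<close> stands for the closed condition \<open>\<sigma> = 0\<close>.
\<close>

definition sentences :: "('f, 'p) signature \<Rightarrow> ('f, 'p) cform set" where
  "sentences L = {\<sigma>. wf_form L \<sigma> \<and> free_vars \<sigma> = {}}"

definition satisfies :: "('f, 'p, 'm) cstructure \<Rightarrow> ('f, 'p) cform \<Rightarrow> bool" where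
  "satisfies M \<sigma> \<longleftrightarrow> (\<forall>v. range v \<subseteq> univ M \<longrightarrow> fval M v \<sigma> = 0)"

definition models ::
  "('f, 'p) signature \<Rightarrow> ('f, 'p, 'm) cstructure \<Rightarrow> ('f, 'p) cform set \<Rightarrow> bool" where
  "models L M T \<longleftrightarrow> is_structure L M \<and> (\<forall>\<sigma>\<in>T. satisfies M \<sigma>)"

definition Th :: "('f, 'p) signature \<Rightarrow> ('f, 'p, 'm) cstructure \<Rightarrow> ('f, 'p) cform set" where
  "Th L M = {\<sigma> \<in> sentences L. satisfies M \<sigma>}"

text \<open>
  HOL does not quantify over types inside a formula, so notions that refer to some or all
  structures carry the type \<open>'u\<close> of their elements as an argument.
\<close>

definition complete_theory ::
  "'u itself \<Rightarrow> ('f, 'p) signature \<Rightarrow> ('f, 'p) cform set \<Rightarrow> bool" where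
  "complete_theory (U :: 'u itself) L T \<longleftrightarrow>
     (\<exists>N :: ('f, 'p, 'u) cstructure. is_structure L N \<and> T = Th L N)"

section \<open>Partitioned formulas and IP\<close>

text \<open>\<open>\<phi>(x;y)\<close> is given by \<open>\<phi>\<close> together with the finite tuples \<open>xs\<close>, \<open>ys\<close> of variables.\<close>

definition partitioned_form ::
  "('f, 'p) signature \<Rightarrow> nat list \<Rightarrow> nat list \<Rightarrow> ('f, 'p) cform \<Rightarrow> bool" where
  "partitioned_form L xs ys \<phi> \<longleftrightarrow>
     wf_form L \<phi> \<and> distinct (xs @ ys) \<and> free_vars \<phi> \<subseteq> set (xs @ ys)"

definition pval ::
  "('f, 'p, 'm) cstructure \<Rightarrow> nat list \<Rightarrow> nat list \<Rightarrow> ('f, 'p) cform \<Rightarrow> 'm list \<Rightarrow> 'm list \<Rightarrow> real" where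
  "pval M xs ys \<phi> a b = fval M (\<lambda>z. the (map_of (zip (xs @ ys) (a @ b)) z)) \<phi>"

definition has_IP ::
  "'u itself \<Rightarrow> ('f, 'p) signature \<Rightarrow> ('f, 'p) cform set \<Rightarrow> nat list \<Rightarrow> nat list \<Rightarrow>
   ('f, 'p) cform \<Rightarrow> bool" where
  "has_IP (U :: 'u itself) L T xs ys \<phi> \<longleftrightarrow>
     (\<exists>N :: ('f, 'p, 'u) cstructure. models L N T \<and>
       (\<exists>r s a. r < s \<and> s \<le> 1 \<and> (\<forall>i::nat. a i \<in> tuples N (length xs)) \<and>
         (\<forall>I :: nat set. \<exists>b\<in>tuples N (length ys).
            (\<forall>i\<in>I. pval N xs ys \<phi> (a i) b \<le> r) \<and> (\<forall>i\<in>-I. s \<le> pval N xs ys \<phi> (a i) b))))"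

text \<open>
  For a complete \<open>T\<close> with a model over \<open>'m\<close>, the type \<open>(nat \<Rightarrow> 'm) set\<close> is large enough for
  \<open>NIP\<close> to mean NIP in all models: if a formula has IP in some model of \<open>T\<close>, then it has IP in an
  ultrapower of the given model along a free ultrafilter on \<open>nat\<close>.
\<close>

definition NIP :: "'u itself \<Rightarrow> ('f, 'p) signature \<Rightarrow> ('f, 'p) cform set \<Rightarrow> bool" where
  "NIP (U :: 'u itself) L T \<longleftrightarrow>
     (\<forall>xs ys \<phi>. partitioned_form L xs ys \<phi> \<longrightarrow> \<not> has_IP U L T xs ys \<phi>)"

section \<open>Average measures and simple randomizations\<close>

text \<open>
  A measure in the variables \<open>xs\<close> is the map sending an instance \<open>\<phi>(x;b)\<close>, given by
  \<open>\<phi>\<close>, the variables \<open>ys\<close> and the parameter \<open>b\<close>, to its value.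
\<close>

type_synonym ('f, 'p, 'm) kmeasure = "('f, 'p) cform \<Rightarrow> nat list \<Rightarrow> 'm list \<Rightarrow> real"

definition Ave ::
  "('f, 'p, 'm) cstructure \<Rightarrow> nat list \<Rightarrow> 'm list list \<Rightarrow> ('f, 'p, 'm) kmeasure" where
  "Ave M xs as = (\<lambda>\<phi> ys b. (\<Sum>a\<leftarrow>as. pval M xs ys \<phi> a b) / real (length as))"

definition average_measure ::
  "('f, 'p, 'm) cstructure \<Rightarrow> nat list \<Rightarrow> ('f, 'p, 'm) kmeasure \<Rightarrow> bool" where
  "average_measure M xs \<mu> \<longleftrightarrow>
     (\<exists>as. as \<noteq> [] \<and> set as \<subseteq> tuples M (length xs) \<and> \<mu> = Ave M xs as)"

definition atomless_fa_prob_space :: "'w set \<Rightarrow> 'w set set \<Rightarrow> ('w set \<Rightarrow> real) \<Rightarrow> bool" where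
  "atomless_fa_prob_space \<Omega> \<B> m \<longleftrightarrow>
     algebra \<Omega> \<B> \<and> (\<forall>A\<in>\<B>. 0 \<le> m A) \<and> m \<Omega> = 1 \<and> Measure_Space.additive \<B> m \<and>
     (\<forall>A\<in>\<B>. 0 < m A \<longrightarrow> (\<exists>C\<in>\<B>. C \<subseteq> A \<and> 0 < m C \<and> m C < m A))"

definition simple_randomization ::
  "'w set \<Rightarrow> 'w set set \<Rightarrow> ('f, 'p, 'm) cstructure \<Rightarrow> ('w \<Rightarrow> 'm) set" where
  "simple_randomization \<Omega> \<B> M =
     {X \<in> \<Omega> \<rightarrow>\<^sub>E univ M. finite (X ` \<Omega>) \<and> (\<forall>a\<in>univ M. X -` {a} \<inter> \<Omega> \<in> \<B>)}"

text \<open>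
  The elements of the simple randomization enter through the uniform averages over finitely many
  parameters from \<open>M\<close>; the condition does not mention the probability space.
\<close>

definition shattered_by_simple ::
  "('f, 'p, 'm) cstructure \<Rightarrow> ('f, 'p) cform \<Rightarrow> nat list \<Rightarrow> real \<Rightarrow> real \<Rightarrow> nat \<Rightarrow>
   (nat \<Rightarrow> ('f, 'p, 'm) kmeasure) \<Rightarrow> bool" where
  "shattered_by_simple M \<phi> ys r s N \<mu> \<longleftrightarrow>
     (\<forall>I\<subseteq>{..<N}. \<exists>bs. bs \<noteq> [] \<and> set bs \<subseteq> tuples M (length ys) \<and>
        (\<forall>i\<in>I. (\<Sum>b\<leftarrow>bs. \<mu> i \<phi> ys b) / real (length bs) \<le> r) \<and>
        (\<forall>i\<in>{..<N} - I. s \<le> (\<Sum>b\<leftarrow>bs. \<mu> i \<phi> ys b) / real (length bs)))"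

end

theory Submission
  imports Defs "HOL-Real_Asymp.Real_Asymp"
begin

text \<open>
  NIP passes to a uniform finite bound in \<open>M\<close>: if sequences of every finite length were shattered
  with a fixed gap \<open>r' < s'\<close>, then by Los' theorem the formula would have IP in an ultrapower of
  \<open>M\<close> along a free ultrafilter on \<open>nat\<close>.

  For averages, consider the mean over all sign patterns \<open>\<sigma>\<close> of
  \<open>sup b. \<Sum>i. \<sigma> i * \<phi> (a i) b\<close>.  It does not grow when the \<open>a i\<close> or \<open>b\<close> are replaced by averages,
  because a maximum dominates a mean; and it is at least \<open>n * (s - r) / 2\<close> for a shattered sequence
  of length \<open>n\<close>.  Hence a shattered sequence of averages yields elements \<open>a 0, \<dots>, a (n - 1)\<close> of \<open>M\<close>
  for which the patterns \<open>(\<phi> (a i) b)\<close>, up to uniform error, are exponentially many.  But a family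
  of patterns of bounded gap dimension has a net of quasi-polynomial size, by the counting argument of
  Alon, Ben-David, Cesa-Bianchi and Haussler, so \<open>n\<close> is bounded.
\<close>

section \<open>Families of integer patterns\<close>

text \<open>The obstacle is that shattering does not pass from averages to the points averaged: for
  each pattern \<open>I\<close> and index \<open>i\<close> a different point may witness the
  inequality. Only the signed sum of all the inequalities survives, so the elements
  \<open>a i\<close> found at the end fit sign patterns well on average, but they need not shatter
  anything. The contradiction must come from this weak information: a finite family that contains,
  for every sign pattern, a member fitting it, with mean correlation \<open>n * c\<close>, has at
  least \<open>exp (c^2 / 4 * n)\<close> members (Massart's finite class estimate). Values are
  rounded down to multiples of \<open>1 / k\<close>. Patterns count as different only when they are
  two levels apart: rounded values at most \<open>u\<close> and at least \<open>u + 2\<close> still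
  force a genuine gap from \<open>(u + 1) / k\<close> to \<open>(u + 2) / k\<close>, whereas
  adjacent levels would force none. The resulting net has fewer than
  \<open>(n * (k + 1)) ^ p\<close> members with \<open>p\<close> of order \<open>log n\<close>. This
  is \<open>exp (O ((log n)^2))\<close>, which drops below \<open>exp (c^2 / 4 * n)\<close> for
  large \<open>n\<close>.\<close>

definition separated_on :: "'i set \<Rightarrow> ('i \<Rightarrow> nat) set \<Rightarrow> bool" where
  "separated_on A F \<longleftrightarrow>
     (\<forall>f\<in>F. \<forall>g\<in>F. f \<noteq> g \<longrightarrow> (\<exists>i\<in>A. f i + 2 \<le> g i \<or> g i + 2 \<le> f i))"

text \<open>The threshold belongs to the shattered object, since different coordinates may have to
  be cut at different levels. With sets of pairs the counting proceeds as for ordinary set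
  systems.\<close>

definition level_shatters :: "('i \<Rightarrow> nat) set \<Rightarrow> ('i \<times> nat) set \<Rightarrow> bool" where
  "level_shatters F H \<longleftrightarrow>
     (\<forall>I\<subseteq>H. \<exists>f\<in>F. (\<forall>(i, u)\<in>I. f i \<le> u) \<and> (\<forall>(i, u)\<in>H - I. u + 2 \<le> f i))"

lemma level_shatters_mono: "level_shatters F H \<Longrightarrow> F \<subseteq> G \<Longrightarrow> level_shatters G H"
  unfolding level_shatters_def by blast

text \<open>The family that supplies the witness decides the new pair: members of \<open>F\<close>
  are low at \<open>i\<close>, members of \<open>G\<close> are high there.\<close>

lemma level_shatters_insert:
  assumes F: "level_shatters F H" and G: "level_shatters G H"
    and lo: "\<And>f. f \<in> F \<Longrightarrow> f i \<le> u" and hi: "\<And>g. g \<in> G \<Longrightarrow> u + 2 \<le> g i"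
  shows "level_shatters (F \<union> G) (insert (i, u) H)"
  unfolding level_shatters_def
proof (intro allI impI)
  fix I assume I: "I \<subseteq> insert (i, u) H"
  show "\<exists>f\<in>F \<union> G. (\<forall>(i, u)\<in>I. f i \<le> u) \<and> (\<forall>(i, u)\<in>insert (i, u) H - I. u + 2 \<le> f i)"
  proof (cases "(i, u) \<in> I")
    case True
    have "I - {(i, u)} \<subseteq> H" using I by auto
    then obtain f where f: "f \<in> F" "\<forall>(j, w)\<in>I - {(i, u)}. f j \<le> w"
        "\<forall>(j, w)\<in>H - (I - {(i, u)}). w + 2 \<le> f j"
      using F unfolding level_shatters_def by meson
    have "\<forall>(j, w)\<in>I. f j \<le> w" using f(2) lo[OF f(1)] by auto
    moreover have "\<forall>(j, w)\<in>insert (i, u) H - I. w + 2 \<le> f j" using f(3) True by auto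
    ultimately show ?thesis using f(1) by blast
  next
    case False
    then have "I \<subseteq> H" using I by auto
    then obtain f where f: "f \<in> G" "\<forall>(j, w)\<in>I. f j \<le> w" "\<forall>(j, w)\<in>H - I. w + 2 \<le> f j"
      using G unfolding level_shatters_def by meson
    have "\<forall>(j, w)\<in>insert (i, u) H - I. w + 2 \<le> f j" using f(3) hi[OF f(1)] by auto
    then show ?thesis using f(1,2) by blast
  qed
qed

text \<open>Discard every member that takes, at some coordinate, a value shared by fewer than
  \<open>p\<close> members. Each of the at most \<open>n * (k + 1)\<close> rare pairs costs at most
  \<open>p - 1\<close> members, so two members remain. They are separated at some coordinate, and
  both of their values there are popular.\<close>

lemma separated_popular_values:
  assumes A: "finite A" "card A \<le> n" and F: "finite F" "\<And>f i. f \<in> F \<Longrightarrow> i \<in> A \<Longrightarrow> f i \<le> k"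
    and sep: "separated_on A F" and big: "n * (k + 1) * p \<le> card F" "p > 0" "2 \<le> n * (k + 1)"
  shows "\<exists>i\<in>A. \<exists>u\<le>k. \<exists>v\<le>k. u + 2 \<le> v \<and> p \<le> card {f \<in> F. f i = u} \<and> p \<le> card {f \<in> F. f i = v}"
proof (rule ccontr)
  assume neg: "\<not> ?thesis"
  define B where "B = {(i, u) \<in> A \<times> {..k}. card {f \<in> F. f i = u} < p}"
  define G where "G = (\<Union>(i, u)\<in>B. {f \<in> F. f i = u})"
  have finB: "finite B" and cardB: "card B \<le> n * (k + 1)"
  proof -
    have sub: "B \<subseteq> A \<times> {..k}" unfolding B_def by auto
    show "finite B" using sub A(1) by (meson finite_SigmaI finite_atMost finite_subset)
    have "card B \<le> card (A \<times> {..k})" using sub A(1) by (intro card_mono) auto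
    also have "\<dots> \<le> n * (k + 1)" using A(2) by (simp add: card_cartesian_product mult_le_mono1 del: mult_Suc_right)
    finally show "card B \<le> n * (k + 1)" .
  qed
  have "card G \<le> (\<Sum>(i, u)\<in>B. card {f \<in> F. f i = u})"
    unfolding G_def using card_UN_le[OF finB, of "\<lambda>(i, u). {f \<in> F. f i = u}"]
    by (simp add: case_prod_unfold)
  also have "\<dots> \<le> (\<Sum>(i, u)\<in>B. p - 1)"
    by (intro sum_mono) (auto simp: B_def)
  also have "\<dots> \<le> n * (k + 1) * (p - 1)" using cardB by (simp add: case_prod_unfold mult_le_mono1 del: mult_Suc_right)
  finally have cG: "card G \<le> n * (k + 1) * (p - 1)" .
  have "n * (k + 1) * p = n * (k + 1) * (p - 1) + n * (k + 1)"
    using big(2) by (cases p) (auto simp: algebra_simps)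
  then have "card G + 2 \<le> card F" using cG big(1,3) by linarith
  moreover have "G \<subseteq> F" unfolding G_def by auto
  ultimately have "2 \<le> card (F - G)"
    using F(1) by (simp add: card_Diff_subset finite_subset)
  then obtain f g where fg: "f \<in> F - G" "g \<in> F - G" "f \<noteq> g"
    by (metis card_le_Suc0_iff_eq F(1) finite_Diff not_less_eq_eq numeral_2_eq_2)
  have pop: "p \<le> card {f' \<in> F. f' i = h i}" if "h \<in> F - G" "i \<in> A" for h i
  proof (rule ccontr)
    assume "\<not> ?thesis"
    then have "(i, h i) \<in> B" using that F(2) unfolding B_def by auto
    then have "h \<in> G" using that unfolding G_def by auto
    then show False using that by auto
  qed
  obtain i where i: "i \<in> A" "f i + 2 \<le> g i \<or> g i + 2 \<le> f i"
    using sep fg unfolding separated_on_def by blast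
  have "f i \<le> k" "g i \<le> k" using F(2) fg i by auto
  with neg i pop[OF fg(1) i(1)] pop[OF fg(2) i(1)] show False by blast
qed

text \<open>This is Pajor's proof of the Sauer-Shelah lemma adapted to gaps. Two popular values at
  \<open>i\<close> give subfamilies \<open>P\<close> and \<open>Q\<close> that are constant at
  \<open>i\<close>, hence separated on the other coordinates. A set shattered by both is counted a
  second time after inserting \<open>(i, u)\<close>, so the two counts add up without loss.\<close>

lemma card_level_shattered_ge:
  assumes A: "finite A" "card A \<le> n" and F: "\<And>f i. f \<in> F \<Longrightarrow> i \<in> A \<Longrightarrow> f i \<le> k"
    and sep: "separated_on A F" and big: "(n * (k + 1)) ^ p \<le> card F" and n: "2 \<le> n * (k + 1)"
  shows "2 ^ p \<le> card {H. H \<subseteq> A \<times> {..k} \<and> level_shatters F H}"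
  using A F sep big
proof (induction p arbitrary: A F)
  case 0
  then obtain f where "f \<in> F" by (metis One_nat_def card.empty ex_in_conv not_one_le_zero power_0)
  then have "{} \<in> {H. H \<subseteq> A \<times> {..k} \<and> level_shatters F H}" by (auto simp: level_shatters_def)
  moreover have "finite {H. H \<subseteq> A \<times> {..k} \<and> level_shatters F H}"
    by (rule finite_subset[of _ "Pow (A \<times> {..k})"]) (use 0(1) in auto)
  ultimately show ?case
    by (metis One_nat_def Suc_leI card_gt_0_iff empty_iff power_0)
next
  case (Suc p)
  let ?C = "n * (k + 1)"
  let ?S = "\<lambda>A F. {H. H \<subseteq> A \<times> {..k} \<and> level_shatters F H}"
  have C0: "?C ^ p > 0" using n by (metis gr0I not_numeral_le_zero zero_less_power)
  \<comment> \<open>\<open>card\<close> is 0 on infinite sets, so a positive lower bound forces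
    \<open>F\<close> to be finite.\<close>
  have "0 < ?C ^ Suc p" using n by (metis gr0I not_numeral_le_zero zero_less_power)
  then have "finite F" using Suc.prems(5) by (metis card.infinite not_le)
  then obtain i u v where iuv: "i \<in> A" "u \<le> k" "v \<le> k" "u + 2 \<le> v"
    "?C ^ p \<le> card {f \<in> F. f i = u}" "?C ^ p \<le> card {f \<in> F. f i = v}"
    using separated_popular_values[where A = A and F = F and n = n and k = k and p = "?C ^ p"]
      Suc.prems C0 n by (auto simp del: add_2_eq_Suc' mult_Suc_right)
  define A' where "A' = A - {i}"
  define P where "P = {f \<in> F. f i = u}"
  define Q where "Q = {f \<in> F. f i = v}"
  have A': "finite A'" "card A' \<le> n"
    using Suc.prems(1,2) card_Diff1_le[of A i] unfolding A'_def by auto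
  have sep': "separated_on A' P" "separated_on A' Q"
    using Suc.prems(4) unfolding separated_on_def A'_def P_def Q_def by fastforce+
  have SP: "2 ^ p \<le> card (?S A' P)"
    using iuv(5) Suc.prems(3) by (intro Suc.IH[OF A' _ sep'(1)]) (auto simp: P_def A'_def)
  have SQ: "2 ^ p \<le> card (?S A' Q)"
    using iuv(6) Suc.prems(3) by (intro Suc.IH[OF A' _ sep'(2)]) (auto simp: Q_def A'_def)
  have fin: "finite (?S B G)" if "finite B" for B and G :: "('a \<Rightarrow> nat) set"
    by (rule finite_subset[of _ "Pow (B \<times> {..k})"]) (use that in auto)
  define J where "J = insert (i, u) ` (?S A' P \<inter> ?S A' Q)"
  have noti: "(i, u) \<notin> H" if "H \<subseteq> A' \<times> {..k}" for H
    using that unfolding A'_def by auto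
  have "inj_on (insert (i, u)) (?S A' P \<inter> ?S A' Q)"
    by (rule inj_onI) (metis (no_types, lifting) IntD1 insert_ident mem_Collect_eq noti)
  then have cJ: "card J = card (?S A' P \<inter> ?S A' Q)" unfolding J_def by (rule card_image)
  have disj: "(?S A' P \<union> ?S A' Q) \<inter> J = {}" using noti unfolding J_def by blast
  have J: "J \<subseteq> ?S A F"
  proof
    fix H assume "H \<in> J"
    then obtain H' where H': "H = insert (i, u) H'" "H' \<subseteq> A' \<times> {..k}" "level_shatters P H'" "level_shatters Q H'"
      unfolding J_def by auto
    have "level_shatters (P \<union> Q) H" unfolding H'(1)
      using H'(3,4) iuv(4) by (intro level_shatters_insert) (auto simp: P_def Q_def)
    then have "level_shatters F H" by (rule level_shatters_mono) (auto simp: P_def Q_def)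
    then show "H \<in> ?S A F" using H' iuv(1,2) unfolding A'_def by auto
  qed
  have PQ: "?S A' P \<union> ?S A' Q \<subseteq> ?S A F"
    using level_shatters_mono[of P _ F] level_shatters_mono[of Q _ F]
    unfolding A'_def P_def Q_def by auto
  have "2 ^ Suc p \<le> card (?S A' P) + card (?S A' Q)" using SP SQ by simp
  also have "\<dots> = card (?S A' P \<union> ?S A' Q) + card J"
    unfolding cJ using fin[OF A'(1)] by (intro card_Un_Int) auto
  also have "\<dots> = card ((?S A' P \<union> ?S A' Q) \<union> J)"
    using disj fin[OF A'(1)] finite_subset[OF J fin[OF Suc.prems(1)]]
    by (intro card_Un_disjoint[symmetric]) auto
  also have "\<dots> \<le> card (?S A F)"
    using fin[OF Suc.prems(1)] PQ J by (intro card_mono) auto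
  finally show ?case .
qed

lemma card_small_subsets_le:
  assumes "finite B"
  shows "card {H. H \<subseteq> B \<and> card H \<le> D} \<le> (card B + 1) ^ D"
proof -
  let ?E = "{..<D} \<rightarrow>\<^sub>E insert None (Some ` B)"
  have "{H. H \<subseteq> B \<and> card H \<le> D} \<subseteq> (\<lambda>g. {x. Some x \<in> g ` {..<D}}) ` ?E"
  proof
    fix H assume "H \<in> {H. H \<subseteq> B \<and> card H \<le> D}"
    then have H: "H \<subseteq> B" "card H \<le> D" by auto
    then have "finite H" using assms finite_subset by blast
    then obtain e where e: "bij_betw e {..<card H} H"
      using ex_bij_betw_nat_finite[of H] by (auto simp: atLeast0LessThan)
    define g where "g = restrict (\<lambda>j. if j < card H then Some (e j) else None) {..<D}"
    have "g \<in> ?E" using bij_betwE[OF e] H(1) unfolding g_def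
      by (auto simp: restrict_def PiE_def extensional_def subset_iff intro!: imageI)
    moreover have "{x. Some x \<in> g ` {..<D}} = H"
    proof (intro set_eqI iffI)
      fix x assume "x \<in> {x. Some x \<in> g ` {..<D}}"
      then show "x \<in> H" using e unfolding g_def bij_betw_def by (auto split: if_splits)
    next
      fix x assume "x \<in> H"
      then obtain j where "j < card H" "x = e j" using e unfolding bij_betw_def by auto
      then show "x \<in> {x. Some x \<in> g ` {..<D}}"
        using H(2) unfolding g_def by (auto intro!: image_eqI[of _ _ j])
    qed
    ultimately show "H \<in> (\<lambda>g. {x. Some x \<in> g ` {..<D}}) ` ?E" by blast
  qed
  then have "card {H. H \<subseteq> B \<and> card H \<le> D} \<le> card ((\<lambda>g. {x. Some x \<in> g ` {..<D}}) ` ?E)"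
    using assms by (intro card_mono finite_imageI finite_PiE) auto
  also have "\<dots> \<le> card ?E" using assms by (intro card_image_le finite_PiE) auto
  also have "\<dots> = (card B + 1) ^ D"
    using assms by (simp add: card_PiE card_image)
  finally show ?thesis .
qed

text \<open>A level-shattered set splits by level into \<open>k + 1\<close> slices, each shattered
  at a single level and so of size at most \<open>d\<close>. There are too few sets of size at most
  \<open>(k + 1) * d\<close> to reach the \<open>2 ^ p\<close> that a large family would
  shatter.\<close>

lemma separated_card_less:
  assumes A: "finite A" "card A = n" and F: "\<And>f i. f \<in> F \<Longrightarrow> i \<in> A \<Longrightarrow> f i \<le> k"
    and sep: "separated_on A F" and n: "2 \<le> n * (k + 1)"
    and dim: "\<And>u S. u \<le> k \<Longrightarrow> S \<subseteq> A \<Longrightarrow> level_shatters F (S \<times> {u}) \<Longrightarrow> card S \<le> d"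
    and p: "(n * (k + 1) + 1) ^ ((k + 1) * d) < 2 ^ p"
  shows "card F < (n * (k + 1)) ^ p"
proof (rule ccontr)
  assume "\<not> ?thesis"
  then have "2 ^ p \<le> card {H. H \<subseteq> A \<times> {..k} \<and> level_shatters F H}"
    using A F sep n by (intro card_level_shattered_ge[where n = n]) auto
  also have "\<dots> \<le> card {H. H \<subseteq> A \<times> {..k} \<and> card H \<le> (k + 1) * d}"
  proof (intro card_mono Collect_mono impI conjI)
    show "finite {H. H \<subseteq> A \<times> {..k} \<and> card H \<le> (k + 1) * d}"
      by (rule finite_subset[of _ "Pow (A \<times> {..k})"]) (use A in auto)
  next
    fix H assume H: "H \<subseteq> A \<times> {..k} \<and> level_shatters F H"
    show "H \<subseteq> A \<times> {..k}" using H by simp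
    define S where "S u = {i. (i, u) \<in> H}" for u
    have "card (S u) \<le> d" if "u \<le> k" for u
    proof (rule dim[OF that])
      show "S u \<subseteq> A" using H unfolding S_def by auto
      show "level_shatters F (S u \<times> {u})" unfolding level_shatters_def
      proof (intro allI impI)
        fix I assume I: "I \<subseteq> S u \<times> {u}"
        then have "I \<subseteq> H" unfolding S_def by auto
        then obtain f where f: "f \<in> F" "\<forall>(i, u)\<in>I. f i \<le> u" "\<forall>(i, u)\<in>H - I. u + 2 \<le> f i"
          using H unfolding level_shatters_def by meson
        have "\<forall>(i, u)\<in>S u \<times> {u} - I. u + 2 \<le> f i" using f(3) unfolding S_def by auto
        then show "\<exists>f\<in>F. (\<forall>(i, u)\<in>I. f i \<le> u) \<and> (\<forall>(i, u)\<in>S u \<times> {u} - I. u + 2 \<le> f i)"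
          using f(1,2) by blast
      qed
    qed
    moreover have "H = (\<Union>u\<le>k. S u \<times> {u})" using H unfolding S_def by auto
    then have "card H \<le> (\<Sum>u\<le>k. card (S u \<times> {u}))"
      by (metis card_UN_le finite_atMost)
    moreover have "(\<Sum>u\<le>k. card (S u \<times> {u})) \<le> (\<Sum>u\<le>k. d)"
      using calculation(1) by (intro sum_mono) (auto simp: card_cartesian_product)
    ultimately show "card H \<le> (k + 1) * d" by simp
  qed
  also have "\<dots> \<le> (card (A \<times> {..k}) + 1) ^ ((k + 1) * d)"
    using A by (intro card_small_subsets_le) auto
  also have "\<dots> < 2 ^ p" using p A by (simp add: card_cartesian_product)
  finally show False by simp
qed

text \<open>A pattern two levels away from every member of a maximal separated subfamily could be
  added to it. Hence such a subfamily is a net of radius 1.\<close>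

lemma ex_maximal_separated:
  assumes "finite P"
  obtains F where "F \<subseteq> P" "separated_on A F"
    "\<And>g. g \<in> P \<Longrightarrow> \<exists>f\<in>F. \<forall>i\<in>A. f i \<le> g i + 1 \<and> g i \<le> f i + 1"
proof -
  let ?\<F> = "{F. F \<subseteq> P \<and> separated_on A F}"
  have "finite ?\<F>" by (rule finite_subset[of _ "Pow P"]) (use assms in auto)
  moreover have "{} \<in> ?\<F>" by (auto simp: separated_on_def)
  ultimately have "\<exists>F\<in>?\<F>. \<forall>G\<in>?\<F>. F \<subseteq> G \<longrightarrow> F = G"
    by (intro finite_has_maximal) auto
  then obtain F where F: "F \<in> ?\<F>" and "\<forall>G\<in>?\<F>. F \<subseteq> G \<longrightarrow> F = G"
    by (rule bexE) (rule that)
  then have max: "F = G" if "G \<in> ?\<F>" "F \<subseteq> G" for G using that by auto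
  have "\<exists>f\<in>F. \<forall>i\<in>A. f i \<le> g i + 1 \<and> g i \<le> f i + 1" if g: "g \<in> P" for g
  proof (rule ccontr)
    assume neg: "\<not> ?thesis"
    have far: "\<exists>i\<in>A. f i + 2 \<le> g i \<or> g i + 2 \<le> f i" if f: "f \<in> F" for f
    proof -
      obtain i where "i \<in> A" "\<not> (f i \<le> g i + 1 \<and> g i \<le> f i + 1)" using neg f by blast
      then show ?thesis by (intro bexI[of _ i]) auto
    qed
    have "separated_on A (insert g F)"
      using F far unfolding separated_on_def by blast
    then have "F = insert g F" using F g by (intro max) auto
    then have "g \<in> F" by blast
    then show False using far[of g] by auto
  qed
  moreover have "F \<subseteq> P" "separated_on A F" using F by simp_all
  ultimately show thesis using that by metis
qed

section \<open>Correlation with sign patterns\<close>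

text \<open>The sharp exponent is half as large. This one follows from the quadratic bounds of
  \<open>exp\<close> on the unit interval and accounts for the 4 in
  \<open>exp (c^2 / 4 * n)\<close>.\<close>

lemma cosh_le_exp_square:
  fixes x :: real assumes "\<bar>x\<bar> \<le> 1"
  shows "exp x + exp (- x) \<le> 2 * exp (x\<^sup>2)"
proof -
  have *: "exp y + exp (- y) \<le> 2 * exp (y\<^sup>2)" if y: "0 \<le> y" "y \<le> 1" for y :: real
  proof -
    have "exp y \<le> 1 + y + y\<^sup>2" using y by (rule exp_bound)
    moreover have "exp (- y) \<le> 1 - y + y\<^sup>2"
    proof -
      have "1 \<le> (1 - y + y\<^sup>2) * (1 + y)" using y by (simp add: algebra_simps power2_eq_square)
      also have "\<dots> \<le> (1 - y + y\<^sup>2) * exp y"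
        using y exp_ge_add_one_self[of y] by (intro mult_left_mono) auto
      finally show ?thesis by (simp add: exp_minus field_simps)
    qed
    moreover have "1 + y\<^sup>2 \<le> exp (y\<^sup>2)" by (rule exp_ge_add_one_self)
    ultimately show ?thesis by linarith
  qed
  show ?thesis using *[of x] *[of "- x"] assms by (cases "0 \<le> x") auto
qed

text \<open>The sign is negative on \<open>I\<close> because shattering makes the values small on
  \<open>I\<close>; a shattering pattern then correlates positively with its signs.\<close>

definition pm_sign :: "'i set \<Rightarrow> 'i \<Rightarrow> real" where
  "pm_sign I i = (if i \<in> I then - 1 else 1)"

text \<open>Toggling the membership of \<open>i\<close> is an involution of \<open>Pow A\<close>
  that flips the sign.\<close>

lemma sum_sign_Pow:
  assumes "finite A" "i \<in> A"
  shows "(\<Sum>I\<in>Pow A. pm_sign I i) = 0"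
proof -
  let ?h = "\<lambda>I. if i \<in> I then I - {i} else insert i I"
  have "(\<Sum>I\<in>Pow A. pm_sign I i) = (\<Sum>I\<in>Pow A. - pm_sign I i)"
    by (rule sum.reindex_bij_witness[of _ ?h ?h]) (use assms in \<open>auto simp: pm_sign_def\<close>)
  then show ?thesis by (simp add: sum_negf)
qed

lemma sum_exp_sign:
  assumes "finite A"
  shows "(\<Sum>I\<in>Pow A. exp (\<Sum>i\<in>A. pm_sign I i * w i)) = (\<Prod>i\<in>A. exp (- w i) + exp (w i))"
proof -
  have "(\<Prod>i\<in>A. exp (- w i) + exp (w i)) =
      (\<Sum>I\<in>Pow A. (\<Prod>i\<in>I. exp (- w i)) * (\<Prod>i\<in>A - I. exp (w i)))"
    using assms by (rule prod_add)
  also have "\<dots> = (\<Sum>I\<in>Pow A. exp (\<Sum>i\<in>A. pm_sign I i * w i))"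
  proof (intro sum.cong refl)
    fix I assume "I \<in> Pow A"
    then have I: "I \<subseteq> A" by simp
    have "(\<Sum>i\<in>A. pm_sign I i * w i) = (\<Sum>i\<in>A - I. pm_sign I i * w i) + (\<Sum>i\<in>I. pm_sign I i * w i)"
      using sum.subset_diff[OF I assms] by simp
    also have "\<dots> = (\<Sum>i\<in>A - I. w i) + (\<Sum>i\<in>I. - w i)"
      by (intro arg_cong2[of _ _ _ _ "(+)"] sum.cong) (auto simp: pm_sign_def)
    finally show "(\<Prod>i\<in>I. exp (- w i)) * (\<Prod>i\<in>A - I. exp (w i)) = exp (\<Sum>i\<in>A. pm_sign I i * w i)"
      using finite_subset[OF I assms] assms by (simp only: exp_add exp_sum finite_Diff mult.commute)
  qed
  finally show ?thesis by simp
qed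

text \<open>
  The exponential moment of the correlation, bounded below by the tangent line of \<open>exp\<close> at the
  mean, is bounded above by the sum of the exponential moments of the members of \<open>F\<close>.
\<close>

lemma card_ge_of_sign_correlation:
  fixes g :: "'i set \<Rightarrow> 'i \<Rightarrow> real"
  assumes A: "finite A" "card A = n" and F: "finite F" "\<And>f i. f \<in> F \<Longrightarrow> i \<in> A \<Longrightarrow> \<bar>f i\<bar> \<le> 1"
    and g: "\<And>I. I \<subseteq> A \<Longrightarrow> g I \<in> F" and c: "0 \<le> c" "c \<le> 1"
    and corr: "2 ^ n * (real n * c) \<le> (\<Sum>I\<in>Pow A. \<Sum>i\<in>A. pm_sign I i * g I i)"
  shows "exp (c\<^sup>2 / 4 * real n) \<le> real (card F)"
proof -
  \<comment> \<open>This choice maximizes \<open>l * c - l^2\<close>, the exponent gained per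
    coordinate; the maximum is \<open>c^2 / 4\<close>.\<close>
  define l where "l = c / 2"
  define m where "m = l * (real n * c)"
  define Z where "Z f I = (\<Sum>i\<in>A. pm_sign I i * (l * f i))" for f :: "'i \<Rightarrow> real" and I
  have Zl: "Z f I = l * (\<Sum>i\<in>A. pm_sign I i * f i)" for f I
    unfolding Z_def by (simp add: sum_distrib_left mult_ac)
  have "2 ^ n * exp m \<le> 2 ^ n * exp m + exp m * (l * (\<Sum>I\<in>Pow A. \<Sum>i\<in>A. pm_sign I i * g I i) - 2 ^ n * m)"
  proof -
    have "2 ^ n * m = l * (2 ^ n * (real n * c))" by (simp add: m_def)
    also have "\<dots> \<le> l * (\<Sum>I\<in>Pow A. \<Sum>i\<in>A. pm_sign I i * g I i)"
      using corr c by (intro mult_left_mono) (auto simp: l_def)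
    finally show ?thesis by simp
  qed
  also have "\<dots> = (\<Sum>I\<in>Pow A. exp m * (1 + (Z (g I) I - m)))"
    using A by (simp add: Zl sum_distrib_left[symmetric] sum.distrib sum_subtractf card_Pow algebra_simps)
  also have "\<dots> \<le> (\<Sum>I\<in>Pow A. exp (Z (g I) I))"
  proof (intro sum_mono)
    fix I
    have "exp m * (1 + (Z (g I) I - m)) \<le> exp m * exp (Z (g I) I - m)"
      by (intro mult_left_mono exp_ge_add_one_self) auto
    then show "exp m * (1 + (Z (g I) I - m)) \<le> exp (Z (g I) I)" by (simp add: exp_diff)
  qed
  also have "\<dots> \<le> (\<Sum>I\<in>Pow A. \<Sum>f\<in>F. exp (Z f I))"
    using g F(1) by (intro sum_mono member_le_sum) auto
  also have "\<dots> = (\<Sum>f\<in>F. \<Sum>I\<in>Pow A. exp (Z f I))" by (rule sum.swap)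
  also have "\<dots> = (\<Sum>f\<in>F. \<Prod>i\<in>A. exp (- (l * f i)) + exp (l * f i))"
    unfolding Z_def using sum_exp_sign[OF A(1)] by simp
  also have "\<dots> \<le> (\<Sum>f\<in>F. \<Prod>i\<in>A. 2 * exp (l\<^sup>2))"
  proof (intro sum_mono prod_mono conjI)
    fix f i assume fi: "f \<in> F" "i \<in> A"
    have "\<bar>l * f i\<bar> \<le> 1 * 1" unfolding abs_mult using F(2)[OF fi] c by (intro mult_mono) (auto simp: l_def)
    then have "exp (l * f i) + exp (- (l * f i)) \<le> 2 * exp ((l * f i)\<^sup>2)"
      by (intro cosh_le_exp_square) simp
    also have "(l * f i)\<^sup>2 \<le> l\<^sup>2"
      using F(2)[OF fi] by (simp add: power_mult_distrib mult_left_le abs_square_le_1)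
    then have "2 * exp ((l * f i)\<^sup>2) \<le> 2 * exp (l\<^sup>2)" by simp
    finally show "exp (- (l * f i)) + exp (l * f i) \<le> 2 * exp (l\<^sup>2)" by simp
  qed (simp add: add_nonneg_nonneg)
  also have "\<dots> = 2 ^ n * (real (card F) * exp (real n * l\<^sup>2))"
    using A by (simp add: power_mult_distrib exp_of_nat_mult)
  finally have "exp m \<le> real (card F) * exp (real n * l\<^sup>2)" by simp
  then have "exp (m - real n * l\<^sup>2) \<le> real (card F)" by (simp add: exp_diff field_simps)
  moreover have "m - real n * l\<^sup>2 = c\<^sup>2 / 4 * real n"
    unfolding m_def l_def by (simp add: power2_eq_square field_simps)
  ultimately show ?thesis by simp
qed

section \<open>Averages of functions of bounded gap dimension\<close>

definition gap_shatters :: "('a \<Rightarrow> 'b \<Rightarrow> real) \<Rightarrow> 'b set \<Rightarrow> real \<Rightarrow> real \<Rightarrow> ('i \<Rightarrow> 'a) \<Rightarrow> 'i set \<Rightarrow> bool" where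
  "gap_shatters \<phi> Y r s a S \<longleftrightarrow>
     (\<forall>I\<subseteq>S. \<exists>b\<in>Y. (\<forall>i\<in>I. \<phi> (a i) b \<le> r) \<and> (\<forall>i\<in>S - I. s \<le> \<phi> (a i) b))"

lemma gap_shatters_reindex:
  assumes "gap_shatters \<phi> Y r s a S" "inj_on e D" "e ` D \<subseteq> S"
  shows "gap_shatters \<phi> Y r s (a \<circ> e) D"
  unfolding gap_shatters_def
proof (intro allI impI)
  fix I assume I: "I \<subseteq> D"
  then have "e ` I \<subseteq> S" using assms(3) by auto
  then obtain b where b: "b \<in> Y" "\<forall>i\<in>e ` I. \<phi> (a i) b \<le> r" "\<forall>i\<in>S - e ` I. s \<le> \<phi> (a i) b"
    using assms(1) unfolding gap_shatters_def by meson
  have "\<forall>i\<in>D - I. e i \<in> S - e ` I" using assms(2,3) I by (auto simp: inj_on_def)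
  then show "\<exists>b\<in>Y. (\<forall>i\<in>I. \<phi> ((a \<circ> e) i) b \<le> r) \<and> (\<forall>i\<in>D - I. s \<le> \<phi> ((a \<circ> e) i) b)"
    using b by (intro bexI[of _ b]) auto
qed

definition gap_NIP :: "('a \<Rightarrow> 'b \<Rightarrow> real) \<Rightarrow> 'a set \<Rightarrow> 'b set \<Rightarrow> bool" where
  "gap_NIP \<phi> X Y \<longleftrightarrow>
     (\<forall>r s. r < s \<longrightarrow> (\<exists>d. \<forall>a. (\<forall>i<d. a i \<in> X) \<longrightarrow> \<not> gap_shatters \<phi> Y r s a {..<d::nat}))"

text \<open>Rounding produces finitely many gaps, which must be served by a single dimension. The
  sum of their individual bounds dominates each of them.\<close>

lemma gap_NIP_uniform:
  assumes "gap_NIP \<phi> X Y" and "finite R" "\<And>r s. (r, s) \<in> R \<Longrightarrow> r < s"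
  obtains d where "\<And>r s a S. (r, s) \<in> R \<Longrightarrow> finite S \<Longrightarrow> a ` S \<subseteq> X \<Longrightarrow>
    gap_shatters \<phi> Y r s a (S :: 'i set) \<Longrightarrow> card S \<le> d"
proof -
  have "\<forall>q\<in>R. \<exists>d. \<forall>a. (\<forall>i<d. a i \<in> X) \<longrightarrow> \<not> gap_shatters \<phi> Y (fst q) (snd q) a {..<d::nat}"
    using assms(1,3) unfolding gap_NIP_def by (metis prod.collapse)
  then obtain \<delta> where \<delta>: "\<And>q a. q \<in> R \<Longrightarrow> \<forall>i<\<delta> q. a i \<in> X \<Longrightarrow>
      \<not> gap_shatters \<phi> Y (fst q) (snd q) a {..<\<delta> q::nat}"
    by metis
  show thesis
  proof (rule that)
    fix r s a and S :: "'i set"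
    assume q: "(r, s) \<in> R" and S: "finite S" "a ` S \<subseteq> X" and sh: "gap_shatters \<phi> Y r s a S"
    have "card S < \<delta> (r, s)"
    proof (rule ccontr)
      assume "\<not> ?thesis"
      moreover obtain e where e: "bij_betw e {..<card S} S"
        using ex_bij_betw_nat_finite[OF S(1)] by (auto simp: atLeast0LessThan)
      ultimately have e': "inj_on e {..<\<delta> (r, s)}" "e ` {..<\<delta> (r, s)} \<subseteq> S"
        unfolding bij_betw_def by (auto intro: inj_on_subset)
      show False
        using \<delta>[OF q, of "a \<circ> e"] gap_shatters_reindex[OF sh e'] e' S by auto
    qed
    also have "\<delta> (r, s) \<le> (\<Sum>q\<in>R. \<delta> q)" using assms(2) q by (intro member_le_sum) auto
    finally show "card S \<le> (\<Sum>q\<in>R. \<delta> q)" by simp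
  qed
qed

text \<open>The first inequality only asks for \<open>p\<close> of order \<open>log n\<close>, so
  the power in the second is the exponential of a multiple of \<open>(log n)^2\<close>, while the
  right-hand side is exponential in \<open>n\<close>.\<close>

lemma quasipolynomial_less_exponential:
  fixes k d :: nat and e :: real
  assumes "e > 0"
  obtains n p :: nat where "n \<ge> 2" "(n * (k + 1) + 1) ^ ((k + 1) * d) < 2 ^ p"
    "real ((n * (k + 1)) ^ p) \<le> exp (e * real n)"
proof -
  define D where "D = real ((k + 1) * d)"
  define K where "K = real (k + 1)"
  \<comment> \<open>The summand 1 makes the first inequality strict. A further 1 is allowed below
    because \<open>p\<close> is \<open>q\<close> rounded up.\<close>
  define q where "q x = D * log 2 (x * K + 1) + 1" for x :: real
  have "K > 0" "D \<ge> 0" unfolding K_def D_def by auto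
  then have "eventually (\<lambda>x. (D * log 2 (x * K + 1) + 2) * ln (x * K) \<le> e * x) at_top"
    using assms by real_asymp
  then have "eventually (\<lambda>n. (q (real n) + 1) * ln (real n * K) \<le> e * real n \<and> n \<ge> 2) at_top"
    unfolding q_def using filterlim_real_sequentially eventually_ge_at_top[of "2::nat"]
    by (auto simp: eventually_conj_iff add.assoc dest: eventually_compose_filterlim)
  then obtain n :: nat where n: "(q (real n) + 1) * ln (real n * K) \<le> e * real n" "n \<ge> 2"
    by (metis (mono_tags, lifting) eventually_at_top_linorder order_refl)
  define p where "p = nat \<lceil>q (real n)\<rceil>"
  have x: "real n * K \<ge> 1" using mult_mono[of 1 "real n" 1 K] n(2) unfolding K_def by simp
  then have lg: "log 2 (real n * K + 1) \<ge> 0" by simp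
  then have q0: "q (real n) \<ge> 1" unfolding q_def using \<open>D \<ge> 0\<close> by simp
  have p: "q (real n) \<le> real p" "real p \<le> q (real n) + 1"
    unfolding p_def using q0 by linarith+
  have "(real n * K + 1) ^ ((k + 1) * d) = 2 powr (D * log 2 (real n * K + 1))"
    using x by (simp only: D_def mult.commute[of "real ((k + 1) * d)"] powr_powr[symmetric])
      (simp add: powr_realpow del: of_nat_mult of_nat_add mult_Suc)
  also have "\<dots> < 2 powr real p" using p unfolding q_def by simp
  finally have "(real n * K + 1) ^ ((k + 1) * d) < 2 ^ p" by (simp add: powr_realpow)
  then have "real ((n * (k + 1) + 1) ^ ((k + 1) * d)) < real (2 ^ p)"
    unfolding K_def by (simp add: algebra_simps)
  then have 1: "(n * (k + 1) + 1) ^ ((k + 1) * d) < 2 ^ p" by (simp only: of_nat_less_iff)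
  have "real ((n * (k + 1)) ^ p) = (real n * K) ^ p" unfolding K_def by (simp add: algebra_simps)
  also have "\<dots> = exp (real p * ln (real n * K))" using x by (simp add: exp_of_nat_mult)
  also have "\<dots> \<le> exp ((q (real n) + 1) * ln (real n * K))"
    using p x by (simp add: mult_right_mono)
  also have "\<dots> \<le> exp (e * real n)" using n by simp
  finally show thesis using that n(2) 1 by blast
qed

section \<open>Replacing averages by single points\<close>

lemma average_le_some:
  fixes f :: "'a \<Rightarrow> real"
  assumes "xs \<noteq> []"
  obtains x where "x \<in> set xs" "(\<Sum>x\<leftarrow>xs. f x) / real (length xs) \<le> f x"
proof -
  have "\<exists>x\<in>set xs. (\<Sum>x\<leftarrow>xs. f x) / real (length xs) \<le> f x"
  proof (rule ccontr)
    assume "\<not> ?thesis"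
    then have "\<And>x. x \<in> set xs \<Longrightarrow> f x < (\<Sum>x\<leftarrow>xs. f x) / real (length xs)" by auto
    then have "(\<Sum>x\<leftarrow>xs. f x) < (\<Sum>x\<leftarrow>xs. (\<Sum>x\<leftarrow>xs. f x) / real (length xs))"
      using assms by (intro sum_list_strict_mono) auto
    then show False using assms by (simp add: sum_list_triv)
  qed
  then show thesis using that by blast
qed

lemma sum_average:
  fixes g :: "'i \<Rightarrow> 'a \<Rightarrow> real"
  shows "(\<Sum>i\<in>A. c i * ((\<Sum>x\<leftarrow>xs. g i x) / l)) = (\<Sum>x\<leftarrow>xs. \<Sum>i\<in>A. c i * g i x) / l"
proof -
  have "(\<Sum>i\<in>A. c i * (\<Sum>x\<leftarrow>xs. g i x)) = (\<Sum>x\<leftarrow>xs. \<Sum>i\<in>A. c i * g i x)"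
    by (induction xs) (auto simp: sum.distrib algebra_simps)
  then show ?thesis by (simp add: sum_divide_distrib[symmetric])
qed

theorem gap_NIP_averages:
  fixes \<phi> :: "'a \<Rightarrow> 'b \<Rightarrow> real"
  assumes bd: "\<And>a b. a \<in> X \<Longrightarrow> b \<in> Y \<Longrightarrow> \<phi> a b \<in> {0..1}"
    and nip: "gap_NIP \<phi> X Y" and rs: "r < s"
  shows "\<exists>n::nat. \<forall>as. (\<forall>i<n. as i \<noteq> [] \<and> set (as i) \<subseteq> X) \<longrightarrow>
    \<not> gap_shatters
        (\<lambda>as bs. (\<Sum>b\<leftarrow>bs. (\<Sum>a\<leftarrow>as. \<phi> a b) / real (length as)) / real (length bs))
        {bs. bs \<noteq> [] \<and> set bs \<subseteq> Y} r s as {..<n}"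
proof -
  \<comment> \<open>Shattering yields mean correlation \<open>(s - r) / 2\<close> per coordinate.
    Rounding and passing to the net lose at most \<open>2 / k \<le> c\<close>, and a quarter of the
    gap covers both this loss and the remaining correlation \<open>c\<close>.\<close>
  define c where "c = min 1 ((s - r) / 4)"
  have c: "0 < c" "c \<le> 1" "c \<le> (s - r) / 4" using rs unfolding c_def by (auto simp: min_def)
  obtain k :: nat where k: "2 / c < real k" using reals_Archimedean2 by blast
  then have "k > 0" using c by (auto simp: field_simps intro!: Nat.gr0I)
  with k have k0: "k > 0" "2 / real k \<le> c" using c by (auto simp: field_simps)
  \<comment> \<open>With values rounded down to multiples of \<open>1 / k\<close>, level at most
    \<open>u\<close> means a value below \<open>(u + 1) / k\<close>, and level at least
    \<open>u + 2\<close> means a value of at least \<open>(u + 2) / k\<close>.\<close>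
  define R where "R = (\<lambda>u. ((real u + 1) / real k, (real u + 2) / real k)) ` {..k}"
  have R: "r' < s'" if "(r', s') \<in> R" for r' s'
    using that k0 unfolding R_def by (auto simp: divide_strict_right_mono)
  have "finite R" unfolding R_def by simp
  obtain d where d: "\<And>r s a S. (r, s) \<in> R \<Longrightarrow> finite S \<Longrightarrow> a ` S \<subseteq> X \<Longrightarrow>
      gap_shatters \<phi> Y r s a (S :: nat set) \<Longrightarrow> card S \<le> d"
    using gap_NIP_uniform[OF nip \<open>finite R\<close> R, where ?'i = nat] by blast
  have "c\<^sup>2 / 4 > 0" using c by simp
  then obtain n p where n: "n \<ge> 2" and p: "(n * (k + 1) + 1) ^ ((k + 1) * d) < 2 ^ p"
    and small: "real ((n * (k + 1)) ^ p) \<le> exp (c\<^sup>2 / 4 * real n)"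
    by (rule quasipolynomial_less_exponential)
  let ?A = "{..<n}"
  show ?thesis
  proof (intro exI[of _ n] allI impI notI)
    fix as
    assume as: "\<forall>i<n. as i \<noteq> [] \<and> set (as i) \<subseteq> X"
      and sh: "gap_shatters
        (\<lambda>as bs. (\<Sum>b\<leftarrow>bs. (\<Sum>a\<leftarrow>as. \<phi> a b) / real (length as)) / real (length bs))
        {bs. bs \<noteq> [] \<and> set bs \<subseteq> Y} r s as ?A"
    define \<mu> where "\<mu> i b = (\<Sum>a\<leftarrow>as i. \<phi> a b) / real (length (as i))" for i b
    have "\<forall>I\<in>Pow ?A. \<exists>bs. bs \<noteq> [] \<and> set bs \<subseteq> Y \<and>
        (\<forall>i\<in>I. (\<Sum>b\<leftarrow>bs. \<mu> i b) / real (length bs) \<le> r) \<and>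
        (\<forall>i\<in>?A - I. s \<le> (\<Sum>b\<leftarrow>bs. \<mu> i b) / real (length bs))"
      using sh unfolding gap_shatters_def \<mu>_def by simp
    then obtain bs where bs: "\<And>I. I \<subseteq> ?A \<Longrightarrow> bs I \<noteq> []" "\<And>I. I \<subseteq> ?A \<Longrightarrow> set (bs I) \<subseteq> Y"
        "\<And>I i. I \<subseteq> ?A \<Longrightarrow> i \<in> I \<Longrightarrow> (\<Sum>b\<leftarrow>bs I. \<mu> i b) / real (length (bs I)) \<le> r"
        "\<And>I i. I \<subseteq> ?A \<Longrightarrow> i \<in> ?A - I \<Longrightarrow> s \<le> (\<Sum>b\<leftarrow>bs I. \<mu> i b) / real (length (bs I))"
      by (metis PowI)
    define \<nu> where "\<nu> I i = (\<Sum>b\<leftarrow>bs I. \<mu> i b) / real (length (bs I))" for I i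
    \<comment> \<open>Measured from the midpoint of \<open>r\<close> and \<open>s\<close>, every
      signed term is at least half the gap. The midpoint then drops out because the signs cancel
      over all \<open>I\<close>.\<close>
    have "2 ^ n * (real n * ((s - r) / 2)) = (\<Sum>i\<in>?A. \<Sum>I\<in>Pow ?A. (s - r) / 2)"
      by (simp add: card_Pow)
    also have "\<dots> \<le> (\<Sum>i\<in>?A. \<Sum>I\<in>Pow ?A. pm_sign I i * (\<nu> I i - (r + s) / 2))"
    proof (intro sum_mono)
      fix i I assume "i \<in> ?A" "I \<in> Pow ?A"
      then show "(s - r) / 2 \<le> pm_sign I i * (\<nu> I i - (r + s) / 2)"
        using bs(3)[of I i] bs(4)[of I i] unfolding pm_sign_def \<nu>_def[symmetric] by (auto simp: field_simps)
    qed
    also have "\<dots> = (\<Sum>i\<in>?A. (\<Sum>I\<in>Pow ?A. pm_sign I i * \<nu> I i) - (r + s) / 2 * (\<Sum>I\<in>Pow ?A. pm_sign I i))"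
      by (intro sum.cong refl) (simp add: sum_subtractf sum_distrib_left right_diff_distrib mult.commute)
    also have "\<dots> = (\<Sum>i\<in>?A. \<Sum>I\<in>Pow ?A. pm_sign I i * \<nu> I i)"
      by (intro sum.cong refl) (simp add: sum_sign_Pow)
    also have "\<dots> = (\<Sum>I\<in>Pow ?A. \<Sum>i\<in>?A. pm_sign I i * \<nu> I i)" by (rule sum.swap)
    finally have 1: "2 ^ n * (real n * ((s - r) / 2)) \<le> (\<Sum>I\<in>Pow ?A. \<Sum>i\<in>?A. pm_sign I i * \<nu> I i)" .
    \<comment> \<open>For fixed \<open>I\<close> the correlation is an average over
      \<open>bs I\<close>, so one entry does at least as well. It may depend on
      \<open>I\<close>.\<close>
    have "\<exists>b\<in>Y. (\<Sum>i\<in>?A. pm_sign I i * \<nu> I i) \<le> (\<Sum>i\<in>?A. pm_sign I i * \<mu> i b)" if I: "I \<subseteq> ?A" for I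
    proof -
      obtain b where "b \<in> set (bs I)"
        "(\<Sum>b\<leftarrow>bs I. \<Sum>i\<in>?A. pm_sign I i * \<mu> i b) / real (length (bs I)) \<le> (\<Sum>i\<in>?A. pm_sign I i * \<mu> i b)"
        using average_le_some[OF bs(1)[OF I], of "\<lambda>b. \<Sum>i\<in>?A. pm_sign I i * \<mu> i b"] by blast
      then show ?thesis using bs(2)[OF I] unfolding \<nu>_def sum_average by blast
    qed
    then obtain b where b: "\<And>I. I \<subseteq> ?A \<Longrightarrow> b I \<in> Y"
      "\<And>I. I \<subseteq> ?A \<Longrightarrow> (\<Sum>i\<in>?A. pm_sign I i * \<nu> I i) \<le> (\<Sum>i\<in>?A. pm_sign I i * \<mu> i (b I))"
      by metis
    have "(\<Sum>I\<in>Pow ?A. \<Sum>i\<in>?A. pm_sign I i * \<nu> I i) \<le> (\<Sum>I\<in>Pow ?A. \<Sum>i\<in>?A. pm_sign I i * \<mu> i (b I))"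
      by (rule sum_mono) (use b(2) in auto)
    also have "\<dots> = (\<Sum>i\<in>?A. \<Sum>I\<in>Pow ?A. pm_sign I i * \<mu> i (b I))" by (rule sum.swap)
    finally have 2: "(\<Sum>I\<in>Pow ?A. \<Sum>i\<in>?A. pm_sign I i * \<nu> I i)
        \<le> (\<Sum>i\<in>?A. \<Sum>I\<in>Pow ?A. pm_sign I i * \<mu> i (b I))" .
    \<comment> \<open>The order of choice matters: \<open>a i\<close> must not depend on
      \<open>I\<close>. It is therefore chosen after all the \<open>b I\<close>, to dominate the
      whole sum over \<open>I\<close>; for fixed \<open>i\<close> this sum is an average over
      \<open>as i\<close>.\<close>
    have "\<exists>a\<in>X. (\<Sum>I\<in>Pow ?A. pm_sign I i * \<mu> i (b I)) \<le> (\<Sum>I\<in>Pow ?A. pm_sign I i * \<phi> a (b I))" if "i < n" for i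
    proof -
      have ne: "as i \<noteq> []" using as that by blast
      obtain a where "a \<in> set (as i)"
        "(\<Sum>a\<leftarrow>as i. \<Sum>I\<in>Pow ?A. pm_sign I i * \<phi> a (b I)) / real (length (as i)) \<le> (\<Sum>I\<in>Pow ?A. pm_sign I i * \<phi> a (b I))"
        using average_le_some[OF ne, of "\<lambda>a. \<Sum>I\<in>Pow ?A. pm_sign I i * \<phi> a (b I)"] by blast
      then show ?thesis using as that unfolding \<mu>_def sum_average by blast
    qed
    then obtain a where a: "\<And>i. i < n \<Longrightarrow> a i \<in> X"
      "\<And>i. i < n \<Longrightarrow> (\<Sum>I\<in>Pow ?A. pm_sign I i * \<mu> i (b I)) \<le> (\<Sum>I\<in>Pow ?A. pm_sign I i * \<phi> (a i) (b I))"
      by metis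
    have "(\<Sum>i\<in>?A. \<Sum>I\<in>Pow ?A. pm_sign I i * \<mu> i (b I)) \<le> (\<Sum>i\<in>?A. \<Sum>I\<in>Pow ?A. pm_sign I i * \<phi> (a i) (b I))"
      by (rule sum_mono) (use a(2) in auto)
    also have "\<dots> = (\<Sum>I\<in>Pow ?A. \<Sum>i\<in>?A. pm_sign I i * \<phi> (a i) (b I))" by (rule sum.swap)
    finally have 3: "2 ^ n * (real n * ((s - r) / 2)) \<le> (\<Sum>I\<in>Pow ?A. \<Sum>i\<in>?A. pm_sign I i * \<phi> (a i) (b I))"
      using 1 2 by linarith
    \<comment> \<open>Making the rounded pattern extensional outside \<open>?A\<close> leaves only
      finitely many patterns.\<close>
    define pat where "pat b = (\<lambda>i\<in>?A. nat \<lfloor>real k * \<phi> (a i) b\<rfloor>)" for b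
    have pat: "real (pat b i) \<le> real k * \<phi> (a i) b" "real k * \<phi> (a i) b < real (pat b i) + 1" "pat b i \<le> k"
      if "b \<in> Y" "i < n" for b i
    proof -
      have \<phi>: "0 \<le> \<phi> (a i) b" "\<phi> (a i) b \<le> 1" using bd[OF a(1)[OF that(2)] that(1)] by auto
      then have "0 \<le> real k * \<phi> (a i) b" "real k * \<phi> (a i) b \<le> real k * 1"
        by (simp, intro mult_left_mono, simp_all)
      moreover have "real (pat b i) = of_int \<lfloor>real k * \<phi> (a i) b\<rfloor>" using that \<phi> unfolding pat_def by simp
      ultimately show "real (pat b i) \<le> real k * \<phi> (a i) b" "real k * \<phi> (a i) b < real (pat b i) + 1" "pat b i \<le> k"
        by linarith+
    qed
    have "pat ` Y \<subseteq> ?A \<rightarrow>\<^sub>E {..k}"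
    proof
      fix f assume "f \<in> pat ` Y"
      then obtain b where b: "b \<in> Y" "f = pat b" by blast
      show "f \<in> ?A \<rightarrow>\<^sub>E {..k}"
      proof (rule PiE_I)
        show "f i \<in> {..k}" if "i \<in> ?A" for i using that b pat(3) by simp
        show "f i = undefined" if "i \<notin> ?A" for i using that b by (simp add: pat_def)
      qed
    qed
    moreover have "finite (?A \<rightarrow>\<^sub>E {..k})" by (intro finite_PiE) auto
    ultimately have finP: "finite (pat ` Y)" by (rule finite_subset)
    then obtain F where F: "F \<subseteq> pat ` Y" "separated_on ?A F"
      and net: "\<And>g. g \<in> pat ` Y \<Longrightarrow> \<exists>f\<in>F. \<forall>i\<in>?A. f i \<le> g i + 1 \<and> g i \<le> f i + 1"
      using ex_maximal_separated[of "pat ` Y" ?A] by metis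
    have Fk: "f i \<le> k" if "f \<in> F" "i \<in> ?A" for f i using that F(1) pat(3) by auto
    have "card F < (n * (k + 1)) ^ p"
    proof (rule separated_card_less[of ?A n F k d p])
      show "2 \<le> n * (k + 1)" using n by simp
      show "f i \<le> k" if "f \<in> F" "i \<in> ?A" for f i using that by (rule Fk)
      show "card S \<le> d" if "u \<le> k" "S \<subseteq> ?A" "level_shatters F (S \<times> {u})" for u S
      proof (rule d[of "(real u + 1) / real k" "(real u + 2) / real k" S a])
        show "((real u + 1) / real k, (real u + 2) / real k) \<in> R" using that unfolding R_def by auto
        show "finite S" using that finite_subset by blast
        show "a ` S \<subseteq> X" using that a(1) by auto
        show "gap_shatters \<phi> Y ((real u + 1) / real k) ((real u + 2) / real k) a S"
          unfolding gap_shatters_def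
        proof (intro allI impI)
          fix I assume I: "I \<subseteq> S"
          then have "I \<times> {u} \<subseteq> S \<times> {u}" by auto
          then obtain f where f: "f \<in> F" "\<forall>(i, u)\<in>I \<times> {u}. f i \<le> u"
            "\<forall>(i, u)\<in>S \<times> {u} - I \<times> {u}. u + 2 \<le> f i"
            using \<open>level_shatters F (S \<times> {u})\<close> unfolding level_shatters_def by meson
          obtain b where b: "b \<in> Y" "f = pat b" using f(1) F(1) by auto
          have "\<phi> (a i) b \<le> (real u + 1) / real k" if "i \<in> I" for i
          proof -
            have "i < n" using that I \<open>S \<subseteq> ?A\<close> by auto
            moreover have "f i \<le> u" using f(2) that by auto
            ultimately show ?thesis using pat(2)[OF b(1), of i] b(2) k0(1) by (simp add: field_simps)
          qed
          moreover have "(real u + 2) / real k \<le> \<phi> (a i) b" if "i \<in> S - I" for i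
          proof -
            have "i < n" using that \<open>S \<subseteq> ?A\<close> by auto
            moreover have "u + 2 \<le> f i" using f(3) that by auto
            ultimately show ?thesis using pat(1)[OF b(1), of i] b(2) k0(1) by (simp add: field_simps)
          qed
          ultimately show "\<exists>b\<in>Y. (\<forall>i\<in>I. \<phi> (a i) b \<le> (real u + 1) / real k) \<and>
              (\<forall>i\<in>S - I. (real u + 2) / real k \<le> \<phi> (a i) b)"
            using b(1) by blast
        qed
      qed
    qed (use F(2) p in auto)
    also have "real ((n * (k + 1)) ^ p) \<le> exp (c\<^sup>2 / 4 * real n)" by (rule small)
    finally have lt: "real (card F) < exp (c\<^sup>2 / 4 * real n)" by simp
    have "\<exists>f\<in>F. \<forall>i\<in>?A. f i \<le> pat (b I) i + 1 \<and> pat (b I) i \<le> f i + 1" if "I \<subseteq> ?A" for I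
      using net b(1)[OF that] by blast
    then obtain g where g: "\<And>I. I \<subseteq> ?A \<Longrightarrow> g I \<in> F"
      "\<And>I i. I \<subseteq> ?A \<Longrightarrow> i < n \<Longrightarrow> g I i \<le> pat (b I) i + 1 \<and> pat (b I) i \<le> g I i + 1"
      by (metis lessThan_iff)
    let ?sc = "\<lambda>f i. real (f i) / real k"
    have "exp (c\<^sup>2 / 4 * real n) \<le> real (card (?sc ` F))"
    proof (rule card_ge_of_sign_correlation[of ?A n "?sc ` F" "\<lambda>I. ?sc (g I)"])
      show "finite (?sc ` F)" using F(1) finP finite_subset by blast
      show "\<bar>f i\<bar> \<le> 1" if "f \<in> ?sc ` F" "i \<in> ?A" for f i using that Fk k0 by auto
      show "?sc (g I) \<in> ?sc ` F" if "I \<subseteq> ?A" for I using g(1)[OF that] by blast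
      have "c \<le> (s - r) / 2 - 2 / real k" using c k0 by linarith
      then have "2 ^ n * (real n * c) \<le> 2 ^ n * (real n * ((s - r) / 2 - 2 / real k))"
        by (intro mult_left_mono) simp_all
      also have "\<dots> = 2 ^ n * (real n * ((s - r) / 2)) - (\<Sum>I\<in>Pow ?A. \<Sum>i\<in>?A. 2 / real k)"
        by (simp add: card_Pow right_diff_distrib)
      also have "\<dots> \<le> (\<Sum>I\<in>Pow ?A. \<Sum>i\<in>?A. pm_sign I i * \<phi> (a i) (b I)) - (\<Sum>I\<in>Pow ?A. \<Sum>i\<in>?A. 2 / real k)"
        using 3 by simp
      also have "\<dots> = (\<Sum>I\<in>Pow ?A. \<Sum>i\<in>?A. pm_sign I i * \<phi> (a i) (b I) - 2 / real k)"
        by (simp add: sum_subtractf)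
      also have "\<dots> \<le> (\<Sum>I\<in>Pow ?A. \<Sum>i\<in>?A. pm_sign I i * ?sc (g I) i)"
      proof (intro sum_mono)
        fix I i assume Ii: "I \<in> Pow ?A" "i \<in> ?A"
        \<comment> \<open>One unit of error comes from rounding down, the other from moving to the
          net.\<close>
        then have "\<bar>real k * \<phi> (a i) (b I) - real (g I i)\<bar> \<le> 2"
          using g(2)[of I i] pat(1,2)[of "b I" i] b(1)[of I] by auto
        then have "\<bar>\<phi> (a i) (b I) - ?sc (g I) i\<bar> \<le> 2 / real k"
          using k0 by (simp add: field_simps abs_le_iff)
        then show "pm_sign I i * \<phi> (a i) (b I) - 2 / real k \<le> pm_sign I i * ?sc (g I) i"
          unfolding pm_sign_def by auto
      qed
      finally show "2 ^ n * (real n * c) \<le> (\<Sum>I\<in>Pow ?A. \<Sum>i\<in>?A. pm_sign I i * ?sc (g I) i)" .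
    qed (use c in auto)
    also have "\<dots> \<le> real (card F)"
      using F(1) finP by (simp add: card_image_le finite_subset)
    finally show False using lt by simp
  qed
qed

section \<open>Ultrafilters\<close>

text \<open>In the order of filters a smaller filter has more eventually true properties, so
  ultrafilters are the minimal proper filters.\<close>

definition is_ultrafilter :: "'a filter \<Rightarrow> bool" where
  "is_ultrafilter U \<longleftrightarrow> U \<noteq> bot \<and> (\<forall>F\<le>U. F \<noteq> bot \<longrightarrow> F = U)"

text \<open>Zorn's lemma is applied downwards. The infimum of a nonempty chain is proper, because
  what holds eventually in the infimum already holds eventually in some member.\<close>

lemma ex_ultrafilter_le:
  fixes F0 :: "'a filter"
  assumes "F0 \<noteq> bot"
  obtains U where "is_ultrafilter U" "U \<le> F0"
proof -
  define A where "A = {F. F \<noteq> bot \<and> F \<le> F0}"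
  let ?P = "\<lambda>F G :: 'a filter. G \<le> F"
  have "\<exists>m\<in>A. \<forall>a\<in>A. ?P m a \<longrightarrow> a = m"
  proof (rule predicate_Zorn)
    show "partial_order_on A (relation_of ?P A)"
      unfolding partial_order_on_def preorder_on_def refl_on_def trans_on_def antisym_on_def relation_of_def
      by auto
  next
    fix C assume "C \<in> Chains (relation_of ?P A)"
    then have C: "C \<subseteq> A" "\<And>F G. F \<in> C \<Longrightarrow> G \<in> C \<Longrightarrow> F \<le> G \<or> G \<le> F"
      unfolding Chains_def relation_of_def by blast+
    show "\<exists>u\<in>A. \<forall>a\<in>C. u \<le> a"
    proof (cases "C = {}")
      case True
      then show ?thesis using assms unfolding A_def by auto
    next
      case False
      have "eventually P (Inf C) \<longleftrightarrow> (\<exists>b\<in>C. eventually P b)" for P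
        using C(2) by (intro eventually_Inf_base[OF False]) (metis inf.absorb1 inf.absorb2 order_refl)
      then have "Inf C \<noteq> bot" using C(1) unfolding A_def trivial_limit_def by auto
      moreover have "Inf C \<le> F0"
      proof -
        obtain F where "F \<in> C" using False by blast
        moreover from this have "F \<le> F0" using C(1) unfolding A_def by blast
        ultimately show ?thesis by (rule Inf_lower2)
      qed
      ultimately show ?thesis unfolding A_def by (auto intro!: bexI[of _ "Inf C"] Inf_lower)
    qed
  qed
  then obtain U where U: "U \<in> A" "\<forall>F\<in>A. F \<le> U \<longrightarrow> F = U" by (rule bexE) (rule that)
  have "is_ultrafilter U" unfolding is_ultrafilter_def
  proof (intro conjI allI impI)
    show "U \<noteq> bot" using U(1) unfolding A_def by simp
    fix F assume "F \<le> U" "F \<noteq> bot"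
    moreover have "U \<le> F0" using U(1) unfolding A_def by simp
    ultimately show "F = U" using U(2) unfolding A_def by auto
  qed
  then show thesis using that U(1) unfolding A_def by auto
qed

text \<open>Compactness gives a cluster point \<open>l\<close> of the image filter. Refining
  \<open>U\<close> by the preimages of the neighbourhoods of \<open>l\<close> then gives a proper
  filter, which by minimality is \<open>U\<close> itself, so \<open>l\<close> is a limit.\<close>

lemma ultrafilter_tendsto_compact:
  fixes f :: "'a \<Rightarrow> 'b::topological_space"
  assumes U: "is_ultrafilter U" and K: "compact K" "\<And>x. f x \<in> K"
  obtains l where "l \<in> K" "(f \<longlongrightarrow> l) U"
proof -
  have "filtermap f U \<noteq> bot" using U unfolding is_ultrafilter_def by (simp add: filtermap_bot_iff)
  moreover have "eventually (\<lambda>x. x \<in> K) (filtermap f U)" using K(2) by (simp add: eventually_filtermap)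
  ultimately obtain l where l: "l \<in> K" "inf (nhds l) (filtermap f U) \<noteq> bot"
    using K(1) unfolding compact_filter by blast
  have "inf U (filtercomap f (nhds l)) \<noteq> bot"
  proof
    assume "inf U (filtercomap f (nhds l)) = bot"
    then obtain Q R where QR: "eventually Q U" "eventually R (filtercomap f (nhds l))" "\<And>x. Q x \<Longrightarrow> R x \<Longrightarrow> False"
      unfolding trivial_limit_def eventually_inf by blast
    obtain R' where R': "eventually R' (nhds l)" "\<And>x. R' (f x) \<Longrightarrow> R x"
      using QR(2) unfolding eventually_filtercomap by blast
    have "eventually (\<lambda>y. \<not> R' y) (filtermap f U)"
      unfolding eventually_filtermap using QR(1) by eventually_elim (use QR(3) R'(2) in blast)
    then have "eventually (\<lambda>_. False) (inf (nhds l) (filtermap f U))"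
      unfolding eventually_inf using R'(1) by blast
    then show False using l(2) unfolding trivial_limit_def by blast
  qed
  moreover have "inf U (filtercomap f (nhds l)) \<le> U" by simp
  ultimately have "inf U (filtercomap f (nhds l)) = U" using U unfolding is_ultrafilter_def by blast
  then have "U \<le> filtercomap f (nhds l)" by (simp add: inf.order_iff)
  then show thesis using that l(1) by (simp add: filterlim_iff_le_filtercomap)
qed

section \<open>Values of formulas\<close>

lemma tval_cong: "(\<And>x. x \<in> tvars t \<Longrightarrow> v x = w x) \<Longrightarrow> tval M v t = tval M w t"
proof (induction t)
  case (TApp f ts)
  then have "map (tval M v) ts = map (tval M w) ts" by auto
  then show ?case by (simp only: tval.simps)
qed simp

lemma fval_cong: "(\<And>x. x \<in> free_vars \<phi> \<Longrightarrow> v x = w x) \<Longrightarrow> fval M v \<phi> = fval M w \<phi>"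
proof (induction \<phi> arbitrary: v w)
  case (FDist t u)
  then show ?case using tval_cong[of t v w M] tval_cong[of u v w M] by simp
next
  case (FPred p ts)
  then have "map (tval M v) ts = map (tval M w) ts" by (auto intro!: tval_cong)
  then show ?case by (simp only: fval.simps)
next
  case (FConn u \<phi>s)
  have "map (fval M v) \<phi>s = map (fval M w) \<phi>s"
  proof (rule map_cong[OF refl])
    fix \<psi> assume "\<psi> \<in> set \<phi>s"
    then show "fval M v \<psi> = fval M w \<psi>" using FConn.prems by (intro FConn.IH) auto
  qed
  then show ?case by (simp only: fval.simps)
next
  case (FSup x \<phi>)
  have "fval M (v(x := a)) \<phi> = fval M (w(x := a)) \<phi>" for a using FSup by (intro FSup.IH) auto
  then show ?case by simp
next
  case (FInf x \<phi>)
  have "fval M (v(x := a)) \<phi> = fval M (w(x := a)) \<phi>" for a using FInf by (intro FInf.IH) auto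
  then show ?case by simp
qed

lemma tval_in_univ:
  assumes M: "is_structure L M" and v: "range v \<subseteq> univ M"
  shows "wf_term L t \<Longrightarrow> tval M v t \<in> univ M"
proof (induction t)
  case (TApp f ts)
  then have "map (tval M v) ts \<in> tuples M (farity L f)" "f \<in> fsyms L" by (auto simp: tuples_def)
  then show ?case using M unfolding is_structure_def by simp
qed (use v in auto)

lemma fval_bounds:
  assumes M: "is_structure L M"
  shows "wf_form L \<phi> \<Longrightarrow> range v \<subseteq> univ M \<Longrightarrow> fval M v \<phi> \<in> {0..1}"
proof (induction \<phi> arbitrary: v)
  case (FDist t u)
  then have "tval M v t \<in> univ M" "tval M v u \<in> univ M" using tval_in_univ[OF M] by auto
  then show ?case using M unfolding is_structure_def by simp
next
  case (FPred p ts)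
  then have "map (tval M v) ts \<in> tuples M (parity L p)" "p \<in> psyms L"
    using tval_in_univ[OF M] by (auto simp: tuples_def)
  then show ?case using M unfolding is_structure_def by simp
next
  case (FConn u \<phi>s)
  have "u \<in> topspace (product_topology (\<lambda>_. top_of_set {0..1}) {..<length \<phi>s}) \<rightarrow> topspace (top_of_set {0..1})"
    using FConn.prems(1) unfolding wf_form.simps is_connective_def by (blast dest: continuous_map_funspace)
  moreover have "(\<lambda>i\<in>{..<length \<phi>s}. map (fval M v) \<phi>s ! i) \<in>
      topspace (product_topology (\<lambda>_. top_of_set {0..1::real}) {..<length \<phi>s})"
    using FConn by (auto simp: nth_mem)
  ultimately show ?case unfolding fval.simps by (simp only: funcset_mem topspace_euclidean_subtopology)
next
  case (FSup x \<phi>)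
  have ne: "univ M \<noteq> {}" using M unfolding is_structure_def by simp
  have b: "fval M (v(x := a)) \<phi> \<in> {0..1}" if "a \<in> univ M" for a
    using FSup that by (intro FSup.IH) auto
  obtain a where a: "a \<in> univ M" using ne by blast
  have "bdd_above ((\<lambda>a. fval M (v(x := a)) \<phi>) ` univ M)" using b by (intro bdd_aboveI2[of _ _ 1]) simp
  then have "fval M (v(x := a)) \<phi> \<le> (SUP a\<in>univ M. fval M (v(x := a)) \<phi>)" using a by (rule cSUP_upper2) simp
  moreover have "(SUP a\<in>univ M. fval M (v(x := a)) \<phi>) \<le> 1" using b ne by (intro cSUP_least) auto
  ultimately show ?case using b[OF a] by simp
next
  case (FInf x \<phi>)
  have ne: "univ M \<noteq> {}" using M unfolding is_structure_def by simp
  have b: "fval M (v(x := a)) \<phi> \<in> {0..1}" if "a \<in> univ M" for a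
    using FInf that by (intro FInf.IH) auto
  obtain a where a: "a \<in> univ M" using ne by blast
  have "bdd_below ((\<lambda>a. fval M (v(x := a)) \<phi>) ` univ M)" using b by (intro bdd_belowI2[of _ 0]) simp
  then have "(INF a\<in>univ M. fval M (v(x := a)) \<phi>) \<le> fval M (v(x := a)) \<phi>" using a by (rule cINF_lower2) simp
  moreover have "0 \<le> (INF a\<in>univ M. fval M (v(x := a)) \<phi>)" using b ne by (intro cINF_greatest) auto
  ultimately show ?case using b[OF a] by simp
qed

text \<open>The assignment inside \<open>pval\<close> is unspecified off the listed variables. This
  allows it to be exchanged for one with all its values in the universe, as
  \<open>fval_bounds\<close> and \<open>Los\<close> require.\<close>

lemma pval_eq_fval:
  assumes "partitioned_form L xs ys \<phi>" "length a = length xs" "length b = length ys"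
    and "\<And>i. i < length (xs @ ys) \<Longrightarrow> v ((xs @ ys) ! i) = (a @ b) ! i"
  shows "pval M xs ys \<phi> a b = fval M v \<phi>"
  unfolding pval_def
proof (rule fval_cong)
  fix x assume "x \<in> free_vars \<phi>"
  then have "x \<in> set (xs @ ys)" using assms(1) unfolding partitioned_form_def by blast
  then obtain i where i: "i < length (xs @ ys)" "x = (xs @ ys) ! i" by (metis in_set_conv_nth)
  have "map_of (zip (xs @ ys) (a @ b)) ((xs @ ys) ! i) = Some ((a @ b) ! i)"
    using assms i(1) by (intro map_of_zip_nth) (auto simp: partitioned_form_def)
  then show "the (map_of (zip (xs @ ys) (a @ b)) x) = v x" using assms(4)[OF i(1)] i(2) by simp
qed

section \<open>Ultrapowers of metric structures\<close>

text \<open>The test values stop at 1 because the moduli are controlled only on the interval from 0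
  to 1.\<close>

lemma zero_if_le_all:
  fixes x :: real assumes "0 \<le> x" "\<And>\<epsilon>. \<epsilon> \<in> {0<..1} \<Longrightarrow> x \<le> \<epsilon>"
  shows "x = 0"
proof (rule ccontr)
  assume "x \<noteq> 0"
  then have "x > 0" using assms(1) by simp
  then have "min 1 (x / 2) \<in> {0<..1}" by simp
  from assms(2)[OF this] \<open>x > 0\<close> show False by (simp add: min_def split: if_splits)
qed

locale ultrapower =
  fixes U :: "nat filter" and L :: "('f, 'p) signature" and M :: "('f, 'p, 'm) cstructure"
  assumes ultra: "is_ultrafilter U" and free: "U \<le> sequentially"
    and wf: "wf_signature L" and struct: "is_structure L M"
begin

lemma U_nonbot [simp]: "U \<noteq> bot"
  using ultra unfolding is_ultrafilter_def by simp

lemma tendsto_ulim: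
  fixes f :: "nat \<Rightarrow> real"
  assumes "\<And>n. f n \<in> {0..1}"
  shows "(f \<longlongrightarrow> Lim U f) U"
proof -
  obtain l where "(f \<longlongrightarrow> l) U" using ultrafilter_tendsto_compact[OF ultra, of "{0..1}" f] assms by blast
  then show ?thesis using tendsto_Lim[OF U_nonbot] by blast
qed

section \<open>The ultralimit pseudometric and its quotient\<close>

abbreviation d where "d \<equiv> mdist (metr M)"

definition seqs :: "(nat \<Rightarrow> 'm) set" where
  "seqs = {g. \<forall>n. g n \<in> univ M}"

lemma seqsD: "g \<in> seqs \<Longrightarrow> g n \<in> univ M"
  unfolding seqs_def by simp

text \<open>
  The absolute value matters only outside \<open>seqs\<close>, where the limit may be junk: the locale
  \<open>Metric_space\<close> asks for nonnegative distances between all elements of the type.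
\<close>

definition D :: "(nat \<Rightarrow> 'm) \<Rightarrow> (nat \<Rightarrow> 'm) \<Rightarrow> real" where
  "D g h = \<bar>Lim U (\<lambda>n. d (g n) (h n))\<bar>"

lemma d_bounds: "a \<in> univ M \<Longrightarrow> b \<in> univ M \<Longrightarrow> d a b \<in> {0..1}"
  using struct unfolding is_structure_def by simp

lemma tendsto_D: "g \<in> seqs \<Longrightarrow> h \<in> seqs \<Longrightarrow> ((\<lambda>n. d (g n) (h n)) \<longlongrightarrow> D g h) U"
  unfolding D_def using tendsto_rabs[OF tendsto_ulim[of "\<lambda>n. d (g n) (h n)"]] d_bounds seqsD by auto

lemma D_le: "g \<in> seqs \<Longrightarrow> h \<in> seqs \<Longrightarrow> eventually (\<lambda>n. d (g n) (h n) \<le> e) U \<Longrightarrow> D g h \<le> e"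
  by (rule tendsto_upperbound[OF tendsto_D _ U_nonbot])

lemma D_nonneg [simp]: "0 \<le> D g h"
  unfolding D_def by simp

lemma D_le_1: "g \<in> seqs \<Longrightarrow> h \<in> seqs \<Longrightarrow> D g h \<le> 1"
  using d_bounds seqsD by (intro D_le always_eventually) auto

lemma D_commute: "D g h = D h g"
  unfolding D_def by (simp add: mdist_commute)

lemma D_self:
  assumes "g \<in> seqs"
  shows "D g g = 0"
proof -
  have "d (g n) (g n) = 0" for n using seqsD[OF assms, of n] by (simp add: univ_def)
  then show ?thesis using D_le[OF assms assms, of 0] D_nonneg[of g g] by (simp add: antisym)
qed

lemma D_triangle: "g \<in> seqs \<Longrightarrow> h \<in> seqs \<Longrightarrow> k \<in> seqs \<Longrightarrow> D g k \<le> D g h + D h k"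
  by (rule tendsto_le[OF U_nonbot tendsto_add[OF tendsto_D tendsto_D] tendsto_D])
    (auto intro!: always_eventually mdist_triangle simp: seqs_def univ_def)

lemma D_cong:
  assumes "g \<in> seqs" "g' \<in> seqs" "h \<in> seqs" "h' \<in> seqs" "D g g' = 0" "D h h' = 0"
  shows "D g h = D g' h'"
  using D_triangle[of g g' h] D_triangle[of g' h' h] D_triangle[of g' g h'] D_triangle[of g h h'] assms
    D_commute[of g g'] D_commute[of h h'] by linarith

definition cls :: "(nat \<Rightarrow> 'm) \<Rightarrow> (nat \<Rightarrow> 'm) set" where
  "cls g = {h \<in> seqs. D g h = 0}"

definition rep :: "(nat \<Rightarrow> 'm) set \<Rightarrow> (nat \<Rightarrow> 'm)" where
  "rep c = (SOME g. g \<in> c)"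

lemma cls_eqI:
  assumes "g \<in> seqs" "h \<in> seqs" "D g h = 0"
  shows "cls g = cls h"
  using D_cong[of g h _ _] assms D_self unfolding cls_def by auto

lemma rep_cls: 
  assumes "g \<in> seqs"
  shows "rep (cls g) \<in> seqs" "D (rep (cls g)) g = 0" "cls (rep (cls g)) = cls g"
proof -
  have "g \<in> cls g" using assms D_self unfolding cls_def by simp
  then have "rep (cls g) \<in> cls g" unfolding rep_def by (rule someI[where P = "\<lambda>h. h \<in> cls g"])
  then show *: "rep (cls g) \<in> seqs" "D (rep (cls g)) g = 0" unfolding cls_def by (auto simp: D_commute)
  then show "cls (rep (cls g)) = cls g" using assms by (intro cls_eqI)
qed

definition pointwise :: "('m list \<Rightarrow> 'c) \<Rightarrow> (nat \<Rightarrow> 'm) list \<Rightarrow> nat \<Rightarrow> 'c" where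
  "pointwise I gs n = I (map (\<lambda>g. g n) gs)"

text \<open>Points are classes of sequences at ultralimit distance 0, which places the structure at
  the element type for which \<open>NIP\<close> is assumed. Symbols act on chosen representatives;
  that the choice is harmless is shown in \<open>fint_upow_cls\<close> and
  \<open>pint_upow_cls\<close>.\<close>

definition upow :: "('f, 'p, (nat \<Rightarrow> 'm) set) cstructure" where
  "upow = \<lparr>metr = metric (cls ` seqs, \<lambda>c c'. D (rep c) (rep c')),
     fint = \<lambda>f cs. cls (pointwise (fint M f) (map rep cs)),
     pint = \<lambda>p cs. Lim U (pointwise (pint M p) (map rep cs))\<rparr>"

lemma rep_in: "c \<in> cls ` seqs \<Longrightarrow> rep c \<in> seqs" and cls_rep: "c \<in> cls ` seqs \<Longrightarrow> cls (rep c) = c"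
  using rep_cls by auto

lemma Metric_space_upow: "Metric_space (cls ` seqs) (\<lambda>c c'. D (rep c) (rep c'))"
proof
  fix x y assume "x \<in> cls ` seqs" "y \<in> cls ` seqs"
  then show "D (rep x) (rep y) = 0 \<longleftrightarrow> x = y"
    using cls_eqI[of "rep x" "rep y"] D_self rep_in cls_rep by metis
next
  show "D (rep x) (rep y) = D (rep y) (rep x)" for x y by (rule D_commute)
qed (auto intro!: D_triangle rep_in)

lemma univ_upow: "univ upow = cls ` seqs"
  unfolding univ_def upow_def by (simp add: Metric_space.mspace_metric[OF Metric_space_upow])

lemma mdist_upow: "mdist (metr upow) c c' = D (rep c) (rep c')"
  unfolding upow_def by (simp add: Metric_space.mdist_metric[OF Metric_space_upow])

lemma mdist_upow_cls: "g \<in> seqs \<Longrightarrow> h \<in> seqs \<Longrightarrow> mdist (metr upow) (cls g) (cls h) = D g h"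
  unfolding mdist_upow using rep_cls by (intro D_cong) auto

section \<open>Completeness of the ultrapower\<close>

lemma diagonal_limit:
  assumes e: "\<And>k. e k \<in> seqs" and cau: "\<And>j k. j \<le> k \<Longrightarrow> D (e j) (e k) < inverse (real (Suc j))"
  obtains g where "g \<in> seqs" "\<And>k. D (e k) g \<le> inverse (real (Suc k))"
proof -
  define P where "P k n \<longleftrightarrow> (\<forall>i\<in>{..k}. \<forall>j\<in>{..k}. i \<le> j \<longrightarrow> d (e i n) (e j n) < inverse (real (Suc i)))" for k n
  \<comment> \<open>At coordinate \<open>n\<close> the diagonal follows the latest sequence up to
    which all mutual estimates hold there. The cap \<open>k \<le> n\<close> makes the greatest index
    exist; since \<open>U\<close> is free, every fixed \<open>k\<close> is eventually at most
    \<open>\<kappa> n\<close>.\<close>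
  define \<kappa> where "\<kappa> n = (GREATEST k. k \<le> n \<and> P k n)" for n
  define g where "g n = e (\<kappa> n) n" for n
  have g: "g \<in> seqs" using e unfolding g_def seqs_def by simp
  have evP: "eventually (P k) U" for k
    unfolding P_def
  proof (intro eventually_ball_finite ballI finite_atMost)
    fix i j
    show "eventually (\<lambda>n. i \<le> j \<longrightarrow> d (e i n) (e j n) < inverse (real (Suc i))) U"
      using order_tendstoD(2)[OF tendsto_D[OF e e] cau[of i j]] by (cases "i \<le> j") auto
  qed
  have "D (e k) g \<le> inverse (real (Suc k))" for k
  proof (rule D_le[OF e g])
    have "eventually (\<lambda>n. k \<le> n) U" using free eventually_ge_at_top[of k] by (rule filter_leD)
    with evP[of k] show "eventually (\<lambda>n. d (e k n) (g n) \<le> inverse (real (Suc k))) U"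
    proof eventually_elim
      case (elim n)
      have "\<kappa> n \<le> n \<and> P (\<kappa> n) n" unfolding \<kappa>_def by (rule GreatestI_nat[of _ k n]) (use elim in auto)
      moreover have "k \<le> \<kappa> n" unfolding \<kappa>_def by (rule Greatest_le_nat[of _ k n]) (use elim in auto)
      ultimately have "d (e k n) (g n) < inverse (real (Suc k))" unfolding P_def g_def by simp
      then show ?case by simp
    qed
  qed
  then show thesis using that g by blast
qed

lemma mcomplete_upow: "mcomplete_of (metr upow)"
proof -
  interpret N: Metric_space "cls ` seqs" "\<lambda>c c'. D (rep c) (rep c')" by (rule Metric_space_upow)
  have "N.mcomplete" unfolding N.mcomplete_def
  proof (intro allI impI)
    fix \<sigma> assume "N.MCauchy \<sigma>"
    then have \<sigma>: "\<And>m. \<sigma> m \<in> cls ` seqs"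
      and cau: "\<And>\<epsilon>. \<epsilon> > 0 \<Longrightarrow> \<exists>N. \<forall>p q. N \<le> p \<longrightarrow> N \<le> q \<longrightarrow> D (rep (\<sigma> p)) (rep (\<sigma> q)) < \<epsilon>"
      unfolding N.MCauchy_def by blast+
    define h where "h m = rep (\<sigma> m)" for m
    have h: "h m \<in> seqs" for m using \<sigma> rep_in unfolding h_def by blast
    have "\<exists>N. \<forall>p q. N \<le> p \<longrightarrow> N \<le> q \<longrightarrow> D (h p) (h q) < inverse (real (Suc k))" for k
      unfolding h_def by (rule cau) simp
    then obtain K where K: "\<And>k p q. K k \<le> p \<Longrightarrow> K k \<le> q \<Longrightarrow> D (h p) (h q) < inverse (real (Suc k))"
      by metis
    \<comment> \<open>The partial sums turn the thresholds \<open>K\<close> into a monotone sequence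
      that still dominates them, giving a subsequence with the fast Cauchy rate that
      \<open>diagonal_limit\<close> needs.\<close>
    define K' where "K' k = (\<Sum>j\<le>k. K j)" for k
    have K': "K j \<le> K' k" if "j \<le> k" for j k
      unfolding K'_def using that by (intro member_le_sum) auto
    obtain g where g: "g \<in> seqs" "\<And>k. D (h (K' k)) g \<le> inverse (real (Suc k))"
      using diagonal_limit[of "\<lambda>k. h (K' k)"] h K K' by (metis order_refl)
    have "limitin N.mtopology \<sigma> (cls g) sequentially"
      unfolding N.limit_metric_sequentially
    proof (intro conjI allI impI)
      show "cls g \<in> cls ` seqs" using g by blast
      fix \<epsilon> :: real assume "\<epsilon> > 0"
      then obtain k where k: "inverse (real (Suc k)) < \<epsilon> / 2" using reals_Archimedean[of "\<epsilon> / 2"] by auto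
      have "D (rep (\<sigma> p)) (rep (cls g)) < \<epsilon>" if "K' k \<le> p" for p
      proof -
        have "D (rep (\<sigma> p)) (rep (cls g)) = D (h p) g"
          unfolding h_def[symmetric] using g h rep_cls D_self by (intro D_cong) auto
        also have "\<dots> \<le> D (h p) (h (K' k)) + D (h (K' k)) g" using g h by (intro D_triangle)
        also have "\<dots> < inverse (real (Suc k)) + inverse (real (Suc k))"
          using K[of k p "K' k"] K'[of k k] that g(2)[of k] by linarith
        finally show ?thesis using k by simp
      qed
      then show "\<exists>N. \<forall>n\<ge>N. \<sigma> n \<in> cls ` seqs \<and> D (rep (\<sigma> n)) (rep (cls g)) < \<epsilon>" using \<sigma> by blast
    qed
    then show "\<exists>x. limitin N.mtopology \<sigma> x sequentially" by blast
  qed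
  then show ?thesis unfolding upow_def by simp
qed

section \<open>Interpretation of the symbols\<close>

lemma pointwise_args:
  "length gs = k \<Longrightarrow> set gs \<subseteq> seqs \<Longrightarrow> map (\<lambda>g. g n) gs \<in> tuples M k"
  unfolding tuples_def seqs_def by auto

lemma pointwise_fint_in:
  "f \<in> fsyms L \<Longrightarrow> length gs = farity L f \<Longrightarrow> set gs \<subseteq> seqs \<Longrightarrow> pointwise (fint M f) gs \<in> seqs"
  using struct pointwise_args[of gs "farity L f"] unfolding is_structure_def seqs_def pointwise_def by simp

lemma pointwise_pint_in:
  "p \<in> psyms L \<Longrightarrow> length gs = parity L p \<Longrightarrow> set gs \<subseteq> seqs \<Longrightarrow> pointwise (pint M p) gs n \<in> {0..1}"
  using struct pointwise_args[of gs "parity L p" n] unfolding is_structure_def pointwise_def by blast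

text \<open>A strict bound on an ultralimit holds at \<open>U\<close>-almost every coordinate, and
  finitely many such bounds hold together. This is how the moduli of \<open>M\<close> become
  available for the ultrapower.\<close>

lemma eventually_tuples_within:
  assumes gs: "length gs = k" "set gs \<subseteq> seqs" and hs: "length hs = k" "set hs \<subseteq> seqs"
    and D: "\<And>i. i < k \<Longrightarrow> D (gs ! i) (hs ! i) < \<delta>"
  shows "eventually (\<lambda>n. tuples_within M k \<delta> (map (\<lambda>g. g n) gs) (map (\<lambda>g. g n) hs)) U"
proof -
  have "eventually (\<lambda>n. \<forall>i\<in>{..<k}. d ((gs ! i) n) ((hs ! i) n) < \<delta>) U"
  proof (intro eventually_ball_finite ballI finite_lessThan)
    fix i assume "i \<in> {..<k}"
    then have "gs ! i \<in> seqs" "hs ! i \<in> seqs" "D (gs ! i) (hs ! i) < \<delta>" using gs hs D nth_mem by auto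
    then show "eventually (\<lambda>n. d ((gs ! i) n) ((hs ! i) n) < \<delta>) U"
      using order_tendstoD(2)[OF tendsto_D] by blast
  qed
  then show ?thesis
    by eventually_elim (use gs hs in \<open>auto simp: tuples_within_def\<close>)
qed

lemma D_pointwise_fint_le:
  assumes f: "f \<in> fsyms L" and \<epsilon>: "\<epsilon> \<in> {0<..1}" and gs: "length gs = farity L f" "set gs \<subseteq> seqs"
    and hs: "length hs = farity L f" "set hs \<subseteq> seqs"
    and D: "\<And>i. i < farity L f \<Longrightarrow> D (gs ! i) (hs ! i) < fmodulus L f \<epsilon>"
  shows "D (pointwise (fint M f) gs) (pointwise (fint M f) hs) \<le> \<epsilon>"
proof (rule D_le)
  have "eventually (\<lambda>n. tuples_within M (farity L f) (fmodulus L f \<epsilon>) (map (\<lambda>g. g n) gs) (map (\<lambda>g. g n) hs)) U"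
    using gs hs D by (rule eventually_tuples_within)
  then show "eventually (\<lambda>n. d (pointwise (fint M f) gs n) (pointwise (fint M f) hs n) \<le> \<epsilon>) U"
  proof eventually_elim
    case (elim n)
    then show ?case
      using struct f \<epsilon> pointwise_args[OF gs] pointwise_args[OF hs] unfolding is_structure_def pointwise_def by blast
  qed
qed (use pointwise_fint_in f gs hs in auto)

lemma ulim_pointwise_pint_le:
  assumes p: "p \<in> psyms L" and \<epsilon>: "\<epsilon> \<in> {0<..1}" and gs: "length gs = parity L p" "set gs \<subseteq> seqs"
    and hs: "length hs = parity L p" "set hs \<subseteq> seqs"
    and D: "\<And>i. i < parity L p \<Longrightarrow> D (gs ! i) (hs ! i) < pmodulus L p \<epsilon>"
  shows "\<bar>Lim U (pointwise (pint M p) gs) - Lim U (pointwise (pint M p) hs)\<bar> \<le> \<epsilon>"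
proof (rule tendsto_upperbound[OF tendsto_rabs[OF tendsto_diff[OF tendsto_ulim tendsto_ulim]] _ U_nonbot])
  have "eventually (\<lambda>n. tuples_within M (parity L p) (pmodulus L p \<epsilon>) (map (\<lambda>g. g n) gs) (map (\<lambda>g. g n) hs)) U"
    using gs hs D by (rule eventually_tuples_within)
  then show "eventually (\<lambda>n. \<bar>pointwise (pint M p) gs n - pointwise (pint M p) hs n\<bar> \<le> \<epsilon>) U"
  proof eventually_elim
    case (elim n)
    then show ?case
      using struct p \<epsilon> pointwise_args[OF gs] pointwise_args[OF hs] unfolding is_structure_def pointwise_def by blast
  qed
qed (use pointwise_pint_in p gs hs in blast)+

text \<open>Moduli are positive, so arguments at distance 0 are within every modulus. The values
  therefore differ by at most every \<open>\<epsilon>\<close> and lie in the same class.\<close>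

lemma fint_upow_cls:
  assumes "f \<in> fsyms L" "length gs = farity L f" "set gs \<subseteq> seqs"
  shows "fint upow f (map cls gs) = cls (pointwise (fint M f) gs)"
proof -
  let ?hs = "map (rep \<circ> cls) gs"
  have hs: "length ?hs = farity L f" "set ?hs \<subseteq> seqs" using assms rep_cls by auto
  have "D (pointwise (fint M f) ?hs) (pointwise (fint M f) gs) \<le> \<epsilon>" if "\<epsilon> \<in> {0<..1}" for \<epsilon>
  proof (rule D_pointwise_fint_le[OF assms(1) that hs assms(2,3)])
    fix i assume i: "i < farity L f"
    then have "gs ! i \<in> seqs" using assms by (metis nth_mem subsetD)
    moreover have "fmodulus L f \<epsilon> > 0" using wf assms(1) that unfolding wf_signature_def by auto
    ultimately show "D (?hs ! i) (gs ! i) < fmodulus L f \<epsilon>" using i assms(2) rep_cls by simp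
  qed
  then have "D (pointwise (fint M f) ?hs) (pointwise (fint M f) gs) = 0" by (intro zero_if_le_all) auto
  then have "cls (pointwise (fint M f) ?hs) = cls (pointwise (fint M f) gs)"
    using pointwise_fint_in[OF assms(1)] hs assms by (intro cls_eqI) auto
  then show ?thesis unfolding upow_def by simp
qed

lemma pint_upow_cls:
  assumes "p \<in> psyms L" "length gs = parity L p" "set gs \<subseteq> seqs"
  shows "pint upow p (map cls gs) = Lim U (pointwise (pint M p) gs)"
proof -
  let ?hs = "map (rep \<circ> cls) gs"
  have hs: "length ?hs = parity L p" "set ?hs \<subseteq> seqs" using assms rep_cls by auto
  have "\<bar>Lim U (pointwise (pint M p) ?hs) - Lim U (pointwise (pint M p) gs)\<bar> \<le> \<epsilon>" if "\<epsilon> \<in> {0<..1}" for \<epsilon>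
  proof (rule ulim_pointwise_pint_le[OF assms(1) that hs assms(2,3)])
    fix i assume i: "i < parity L p"
    then have "gs ! i \<in> seqs" using assms by (metis nth_mem subsetD)
    moreover have "pmodulus L p \<epsilon> > 0" using wf assms(1) that unfolding wf_signature_def by auto
    ultimately show "D (?hs ! i) (gs ! i) < pmodulus L p \<epsilon>" using i assms(2) rep_cls by simp
  qed
  then have "\<bar>Lim U (pointwise (pint M p) ?hs) - Lim U (pointwise (pint M p) gs)\<bar> = 0"
    by (intro zero_if_le_all) auto
  then show ?thesis unfolding upow_def by simp
qed

lemma tuples_upow:
  assumes "cs \<in> tuples upow k"
  obtains gs where "cs = map cls gs" "length gs = k" "set gs \<subseteq> seqs"
proof (rule that[of "map rep cs"])
  have cs: "length cs = k" "set cs \<subseteq> cls ` seqs" using assms unfolding tuples_def univ_upow by auto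
  then show "length (map rep cs) = k" "set (map rep cs) \<subseteq> seqs" using rep_in by auto
  have "map (cls \<circ> rep) cs = cs" using cs cls_rep by (intro map_idI) auto
  then show "cs = map cls (map rep cs)" by simp
qed

lemma tuples_within_upowD:
  assumes "tuples_within upow k \<delta> (map cls gs) (map cls hs)" "length gs = k" "set gs \<subseteq> seqs"
    "length hs = k" "set hs \<subseteq> seqs" "i < k"
  shows "D (gs ! i) (hs ! i) < \<delta>"
proof -
  have "gs ! i \<in> seqs" "hs ! i \<in> seqs" using assms by (metis nth_mem subsetD)+
  then show ?thesis using assms mdist_upow_cls[of "gs ! i" "hs ! i"] unfolding tuples_within_def by auto
qed

lemma is_structure_upow: "is_structure L upow"
  unfolding is_structure_def
proof (intro conjI ballI impI)
  obtain a where "a \<in> univ M" using struct unfolding is_structure_def by blast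
  then have "(\<lambda>_. a) \<in> seqs" unfolding seqs_def by simp
  then show "univ upow \<noteq> {}" unfolding univ_upow by blast
next
  show "mcomplete_of (metr upow)" by (rule mcomplete_upow)
next
  fix a b assume "a \<in> univ upow" "b \<in> univ upow"
  then show "mdist (metr upow) a b \<le> 1" unfolding mdist_upow univ_upow using rep_in D_le_1 by blast
next
  fix f a assume f: "f \<in> fsyms L" and "a \<in> tuples upow (farity L f)"
  then obtain gs where gs: "a = map cls gs" "length gs = farity L f" "set gs \<subseteq> seqs" by (elim tuples_upow)
  then show "fint upow f a \<in> univ upow" using fint_upow_cls[OF f gs(2,3)] pointwise_fint_in[OF f gs(2,3)]
    by (simp add: univ_upow)
next
  fix p a assume p: "p \<in> psyms L" and "a \<in> tuples upow (parity L p)"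
  then obtain gs where gs: "a = map cls gs" "length gs = parity L p" "set gs \<subseteq> seqs" by (elim tuples_upow)
  have "Lim U (pointwise (pint M p) gs) \<in> {0..1}"
    using closed_atLeastAtMost pointwise_pint_in[OF p gs(2,3)]
    by (intro Lim_in_closed_set[OF _ _ _ tendsto_ulim]) auto
  then show "pint upow p a \<in> {0..1}" using pint_upow_cls[OF p gs(2,3)] gs(1) by simp
next
  fix f \<epsilon> a b assume f: "f \<in> fsyms L" and \<epsilon>: "\<epsilon> \<in> {0<..1::real}"
    and a: "a \<in> tuples upow (farity L f)" and b: "b \<in> tuples upow (farity L f)"
    and w: "tuples_within upow (farity L f) (fmodulus L f \<epsilon>) a b"
  obtain gs where gs: "a = map cls gs" "length gs = farity L f" "set gs \<subseteq> seqs" using a by (elim tuples_upow)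
  obtain hs where hs: "b = map cls hs" "length hs = farity L f" "set hs \<subseteq> seqs" using b by (elim tuples_upow)
  have "D (pointwise (fint M f) gs) (pointwise (fint M f) hs) \<le> \<epsilon>"
    using D_pointwise_fint_le[OF f \<epsilon> gs(2,3) hs(2,3)] tuples_within_upowD[OF w[unfolded gs hs] gs(2,3) hs(2,3)] by blast
  then show "mdist (metr upow) (fint upow f a) (fint upow f b) \<le> \<epsilon>"
    unfolding gs(1) hs(1) fint_upow_cls[OF f gs(2,3)] fint_upow_cls[OF f hs(2,3)]
    using mdist_upow_cls pointwise_fint_in[OF f gs(2,3)] pointwise_fint_in[OF f hs(2,3)] by simp
next
  fix p \<epsilon> a b assume p: "p \<in> psyms L" and \<epsilon>: "\<epsilon> \<in> {0<..1::real}"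
    and a: "a \<in> tuples upow (parity L p)" and b: "b \<in> tuples upow (parity L p)"
    and w: "tuples_within upow (parity L p) (pmodulus L p \<epsilon>) a b"
  obtain gs where gs: "a = map cls gs" "length gs = parity L p" "set gs \<subseteq> seqs" using a by (elim tuples_upow)
  obtain hs where hs: "b = map cls hs" "length hs = parity L p" "set hs \<subseteq> seqs" using b by (elim tuples_upow)
  show "\<bar>pint upow p a - pint upow p b\<bar> \<le> \<epsilon>"
    unfolding gs(1) hs(1) pint_upow_cls[OF p gs(2,3)] pint_upow_cls[OF p hs(2,3)]
    using ulim_pointwise_pint_le[OF p \<epsilon> gs(2,3) hs(2,3)] tuples_within_upowD[OF w[unfolded gs hs] gs(2,3) hs(2,3)] by blast
qed

section \<open>Terms, quantifiers and Los' theorem\<close>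

lemma tval_in_seqs:
  assumes "\<And>x. w x \<in> seqs" "wf_term L t"
  shows "(\<lambda>n. tval M (\<lambda>x. w x n) t) \<in> seqs"
proof -
  have "range (\<lambda>x. w x n) \<subseteq> univ M" for n using seqsD[OF assms(1)] by auto
  then show ?thesis using tval_in_univ[OF struct _ assms(2)] unfolding seqs_def by simp
qed

lemma tval_upow:
  assumes w: "\<And>x. w x \<in> seqs"
  shows "wf_term L t \<Longrightarrow> tval upow (\<lambda>x. cls (w x)) t = cls (\<lambda>n. tval M (\<lambda>x. w x n) t)"
proof (induction t)
  case (TApp f ts)
  let ?gs = "map (\<lambda>t n. tval M (\<lambda>x. w x n) t) ts"
  have gs: "length ?gs = farity L f" "set ?gs \<subseteq> seqs"
    using TApp.prems tval_in_seqs[of w, OF w] by auto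
  have "map (tval upow (\<lambda>x. cls (w x))) ts = map cls ?gs" using TApp by auto
  then have "tval upow (\<lambda>x. cls (w x)) (TApp f ts) = fint upow f (map cls ?gs)" by (simp only: tval.simps)
  also have "\<dots> = cls (pointwise (fint M f) ?gs)" using TApp.prems gs by (intro fint_upow_cls) auto
  also have "pointwise (fint M f) ?gs = (\<lambda>n. tval M (\<lambda>x. w x n) (TApp f ts))"
    by (simp add: pointwise_def comp_def fun_eq_iff)
  finally show ?case .
qed simp

text \<open>Each class gives a lower bound for the limit of the suprema. Conversely, picking at
  coordinate \<open>n\<close> a point within \<open>1 / (n + 1)\<close> of the supremum defines one
  class attaining that limit, as the errors vanish along the free ultrafilter.\<close>

lemma tendsto_SUP_upow:
  assumes F: "\<And>n a. a \<in> univ M \<Longrightarrow> F n a \<in> {0..1::real}"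
    and G: "\<And>a. a \<in> seqs \<Longrightarrow> ((\<lambda>n. F n (a n)) \<longlongrightarrow> G (cls a)) U"
    and G1: "\<And>c. c \<in> univ upow \<Longrightarrow> G c \<le> 1"
  shows "((\<lambda>n. SUP a\<in>univ M. F n a) \<longlongrightarrow> (SUP c\<in>univ upow. G c)) U"
proof -
  define s where "s n = (SUP a\<in>univ M. F n a)" for n
  have ne: "univ M \<noteq> {}" using struct unfolding is_structure_def by simp
  have bdd: "bdd_above (F n ` univ M)" for n using F by (intro bdd_aboveI2[of _ _ 1]) simp
  have le_s: "F n a \<le> s n" if "a \<in> univ M" for n a unfolding s_def using bdd that by (rule cSUP_upper[rotated])
  have s1: "s n \<in> {0..1}" for n
  proof -
    obtain a where a: "a \<in> univ M" using ne by blast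
    have "s n \<le> 1" unfolding s_def using F ne by (intro cSUP_least) auto
    then show ?thesis using le_s[OF a, of n] F[OF a, of n] by simp
  qed
  have lim: "(s \<longlongrightarrow> Lim U s) U" using s1 by (rule tendsto_ulim)
  have "(SUP c\<in>univ upow. G c) = Lim U s"
  proof (rule antisym)
    show "(SUP c\<in>univ upow. G c) \<le> Lim U s"
    proof (rule cSUP_least)
      show "univ upow \<noteq> {}" using is_structure_upow unfolding is_structure_def by simp
      fix c assume "c \<in> univ upow"
      then obtain a where a: "a \<in> seqs" "c = cls a" unfolding univ_upow by blast
      show "G c \<le> Lim U s" unfolding a(2)
        using le_s seqsD[OF a(1)] by (intro tendsto_le[OF U_nonbot lim G[OF a(1)]] always_eventually) auto
    qed
    have "\<exists>a\<in>univ M. s n - inverse (real (Suc n)) < F n a" for n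
      using less_cSUP_iff[OF ne bdd, of "s n - inverse (real (Suc n))" n] unfolding s_def by simp
    then obtain a where a: "\<And>n. a n \<in> univ M" "\<And>n. s n - inverse (real (Suc n)) < F n (a n)" by metis
    have aS: "a \<in> seqs" using a(1) unfolding seqs_def by simp
    have "((\<lambda>n. inverse (real (Suc n))) \<longlongrightarrow> 0) U"
      using LIMSEQ_inverse_real_of_nat free by (rule tendsto_mono[rotated])
    then have "((\<lambda>n. s n - inverse (real (Suc n))) \<longlongrightarrow> Lim U s - 0) U" by (rule tendsto_diff[OF lim])
    then have "Lim U s - 0 \<le> G (cls a)"
      using a(2) by (intro tendsto_le[OF U_nonbot G[OF aS]] always_eventually) (auto intro: less_imp_le)
    also have "\<dots> \<le> (SUP c\<in>univ upow. G c)"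
      using G1 aS by (intro cSUP_upper bdd_aboveI2[of _ _ 1]) (auto simp: univ_upow)
    finally show "Lim U s \<le> (SUP c\<in>univ upow. G c)" by simp
  qed
  then show ?thesis using lim unfolding s_def by simp
qed

text \<open>The reflection \<open>h \<mapsto> 1 - h\<close> of the unit interval exchanges infima
  and suprema.\<close>

lemma tendsto_INF_upow:
  assumes F: "\<And>n a. a \<in> univ M \<Longrightarrow> F n a \<in> {0..1::real}"
    and G: "\<And>a. a \<in> seqs \<Longrightarrow> ((\<lambda>n. F n (a n)) \<longlongrightarrow> G (cls a)) U"
    and G0: "\<And>c. c \<in> univ upow \<Longrightarrow> 0 \<le> G c"
  shows "((\<lambda>n. INF a\<in>univ M. F n a) \<longlongrightarrow> (INF c\<in>univ upow. G c)) U"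
proof -
  have INF_eq: "(INF a\<in>A. h a) = 1 - (SUP a\<in>A. 1 - h a)"
    if "A \<noteq> {}" "\<And>a. a \<in> A \<Longrightarrow> 0 \<le> h a" for A :: "'z set" and h :: "'z \<Rightarrow> real"
  proof (rule antisym)
    have bb: "bdd_below (h ` A)" using that(2) by (rule bdd_belowI2)
    have ba: "bdd_above ((\<lambda>a. 1 - h a) ` A)" using that(2) by (intro bdd_aboveI2[of _ _ 1]) simp
    have "(SUP a\<in>A. 1 - h a) \<le> 1 - (INF a\<in>A. h a)"
      using that(1) cINF_lower[OF bb] by (intro cSUP_least) auto
    then show "(INF a\<in>A. h a) \<le> 1 - (SUP a\<in>A. 1 - h a)" by simp
    show "1 - (SUP a\<in>A. 1 - h a) \<le> (INF a\<in>A. h a)"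
      using that(1) cSUP_upper[OF _ ba] by (intro cINF_greatest) (auto simp: algebra_simps)
  qed
  have "((\<lambda>n. 1 - (SUP a\<in>univ M. 1 - F n a)) \<longlongrightarrow> 1 - (SUP c\<in>univ upow. 1 - G c)) U"
    using F G G0 by (intro tendsto_intros tendsto_SUP_upow[where F = "\<lambda>n a. 1 - F n a"]) auto
  moreover have "(INF a\<in>univ M. F n a) = 1 - (SUP a\<in>univ M. 1 - F n a)" for n
    using F struct unfolding is_structure_def by (intro INF_eq) auto
  moreover have "(INF c\<in>univ upow. G c) = 1 - (SUP c\<in>univ upow. 1 - G c)"
    using G0 is_structure_upow unfolding is_structure_def by (intro INF_eq) auto
  ultimately show ?thesis by simp
qed

theorem Los:
  assumes "\<And>x. w x \<in> seqs" "wf_form L \<phi>"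
  shows "((\<lambda>n. fval M (\<lambda>x. w x n) \<phi>) \<longlongrightarrow> fval upow (\<lambda>x. cls (w x)) \<phi>) U"
  using assms
proof (induction \<phi> arbitrary: w)
  case (FDist t u)
  then show ?case
    using tval_in_seqs[of w] tval_upow[of w] tendsto_D by (simp add: mdist_upow_cls)
next
  case (FPred p ts)
  let ?gs = "map (\<lambda>t n. tval M (\<lambda>x. w x n) t) ts"
  have p: "p \<in> psyms L" and gs: "length ?gs = parity L p" "set ?gs \<subseteq> seqs"
    using FPred.prems tval_in_seqs[of w] by auto
  have "map (tval upow (\<lambda>x. cls (w x))) ts = map cls ?gs" using FPred tval_upow[of w] by auto
  then have "fval upow (\<lambda>x. cls (w x)) (FPred p ts) = Lim U (pointwise (pint M p) ?gs)"
    using pint_upow_cls[OF p gs] by (simp only: fval.simps)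
  moreover have "pointwise (pint M p) ?gs = (\<lambda>n. fval M (\<lambda>x. w x n) (FPred p ts))"
    by (simp add: pointwise_def comp_def fun_eq_iff)
  ultimately show ?case using tendsto_ulim pointwise_pint_in[OF p gs] by metis
next
  case (FConn u \<phi>s)
  let ?k = "length \<phi>s"
  let ?X = "product_topology (\<lambda>_. top_of_set {0..1::real}) {..<?k}"
  let ?f = "\<lambda>n. \<lambda>i\<in>{..<?k}. map (fval M (\<lambda>x. w x n)) \<phi>s ! i"
  let ?l = "\<lambda>i\<in>{..<?k}. map (fval upow (\<lambda>x. cls (w x))) \<phi>s ! i"
  have u: "continuous_map ?X (top_of_set {0..1}) u" and wfs: "\<And>\<psi>. \<psi> \<in> set \<phi>s \<Longrightarrow> wf_form L \<psi>"
    using FConn.prems by (auto simp: is_connective_def)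
  have bM: "fval M (\<lambda>x. w x n) \<psi> \<in> {0..1}" if "\<psi> \<in> set \<phi>s" for n \<psi>
    using FConn.prems(1) wfs that seqsD by (intro fval_bounds[OF struct]) auto
  have bU: "fval upow (\<lambda>x. cls (w x)) \<psi> \<in> {0..1}" if "\<psi> \<in> set \<phi>s" for \<psi>
    using FConn.prems(1) wfs that by (intro fval_bounds[OF is_structure_upow]) (auto simp: univ_upow)
  \<comment> \<open>Connectives are continuous for the product topology, where convergence is
    coordinatewise and so reduces to the induction hypotheses.\<close>
  have "limitin ?X ?f ?l U"
    unfolding limitin_componentwise
  proof (intro conjI ballI)
    show "eventually (\<lambda>n. ?f n \<in> topspace ?X) U"
      using bM by (intro always_eventually) auto
    fix i assume i: "i \<in> {..<?k}"
    then have mem: "\<phi>s ! i \<in> set \<phi>s" by simp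
    show "limitin (top_of_set {0..1}) (\<lambda>n. ?f n i) (?l i) U"
      unfolding limitin_subtopology
    proof (intro conjI)
      show "?l i \<in> {0..1}" using i bU[OF mem] by simp
      show "eventually (\<lambda>n. ?f n i \<in> {0..1}) U" using i bM[OF mem] by simp
      show "limitin euclidean (\<lambda>n. ?f n i) (?l i) U" using i FConn.IH[OF mem, of w] FConn.prems(1) wfs[OF mem] by simp
    qed
  qed auto
  from continuous_map_limit[OF u this] have "((u \<circ> ?f) \<longlongrightarrow> u ?l) U"
    unfolding limitin_subtopology by simp
  then show ?case by (simp add: comp_def)
next
  case (FSup x \<phi>)
  \<comment> \<open>The quantified value is moved into the family \<open>w\<close> of sequences, so
    that the induction hypothesis applies to \<open>w(x := a)\<close>.\<close>
  have upd: "fval M ((\<lambda>y. w y n)(x := a n)) \<phi> = fval M (\<lambda>y. (w(x := a)) y n) \<phi>"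
    "fval upow ((\<lambda>y. cls (w y))(x := cls a)) \<phi> = fval upow (\<lambda>y. cls ((w(x := a)) y)) \<phi>" for a n
    by (rule fval_cong; simp)+
  show ?case unfolding fval.simps
  proof (rule tendsto_SUP_upow)
    show "fval M ((\<lambda>y. w y n)(x := a)) \<phi> \<in> {0..1}" if "a \<in> univ M" for n a
      using FSup.prems that seqsD by (intro fval_bounds[OF struct]) auto
    show "fval upow ((\<lambda>y. cls (w y))(x := c)) \<phi> \<le> 1" if "c \<in> univ upow" for c
      using fval_bounds[OF is_structure_upow, of \<phi> "(\<lambda>y. cls (w y))(x := c)"] FSup.prems that by (auto simp: univ_upow)
    show "((\<lambda>n. fval M ((\<lambda>y. w y n)(x := a n)) \<phi>) \<longlongrightarrow> fval upow ((\<lambda>y. cls (w y))(x := cls a)) \<phi>) U"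
      if "a \<in> seqs" for a
      unfolding upd using FSup.prems that by (intro FSup.IH) auto
  qed
next
  case (FInf x \<phi>)
  have upd: "fval M ((\<lambda>y. w y n)(x := a n)) \<phi> = fval M (\<lambda>y. (w(x := a)) y n) \<phi>"
    "fval upow ((\<lambda>y. cls (w y))(x := cls a)) \<phi> = fval upow (\<lambda>y. cls ((w(x := a)) y)) \<phi>" for a n
    by (rule fval_cong; simp)+
  show ?case unfolding fval.simps
  proof (rule tendsto_INF_upow)
    show "fval M ((\<lambda>y. w y n)(x := a)) \<phi> \<in> {0..1}" if "a \<in> univ M" for n a
      using FInf.prems that seqsD by (intro fval_bounds[OF struct]) auto
    show "0 \<le> fval upow ((\<lambda>y. cls (w y))(x := c)) \<phi>" if "c \<in> univ upow" for c
      using fval_bounds[OF is_structure_upow, of \<phi> "(\<lambda>y. cls (w y))(x := c)"] FInf.prems that by (auto simp: univ_upow)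
    show "((\<lambda>n. fval M ((\<lambda>y. w y n)(x := a n)) \<phi>) \<longlongrightarrow> fval upow ((\<lambda>y. cls (w y))(x := cls a)) \<phi>) U"
      if "a \<in> seqs" for a
      unfolding upd using FInf.prems that by (intro FInf.IH) auto
  qed
qed

lemma models_upow:
  assumes "models L M T" "T \<subseteq> sentences L"
  shows "models L upow T"
  unfolding models_def satisfies_def
proof (intro conjI ballI allI impI)
  show "is_structure L upow" by (rule is_structure_upow)
  fix \<sigma> and v :: "nat \<Rightarrow> (nat \<Rightarrow> 'm) set"
  assume \<sigma>: "\<sigma> \<in> T" and v: "range v \<subseteq> univ upow"
  define w where "w x = rep (v x)" for x :: nat
  have vx: "v x \<in> cls ` seqs" for x using v unfolding univ_upow by auto
  have w: "w x \<in> seqs" and vw: "v x = cls (w x)" for x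
    using rep_in[OF vx] cls_rep[OF vx] unfolding w_def by auto
  have "fval M (\<lambda>x. w x n) \<sigma> = 0" for n
    using assms(1) \<sigma> seqsD[OF w] unfolding models_def satisfies_def by (metis image_subsetI)
  moreover have "((\<lambda>n. fval M (\<lambda>x. w x n) \<sigma>) \<longlongrightarrow> fval upow (\<lambda>x. cls (w x)) \<sigma>) U"
    using assms(2) \<sigma> w by (intro Los) (auto simp: sentences_def)
  ultimately have "((\<lambda>n. 0) \<longlongrightarrow> fval upow (\<lambda>x. cls (w x)) \<sigma>) U" by simp
  then have "fval upow (\<lambda>x. cls (w x)) \<sigma> = 0" using tendsto_unique[OF U_nonbot _ tendsto_const] by blast
  moreover have "v = (\<lambda>x. cls (w x))" using vw by blast
  ultimately show "fval upow v \<sigma> = 0" by simp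
qed

section \<open>Tuples and instances of partitioned formulas\<close>

definition tuple_cls :: "nat \<Rightarrow> (nat \<Rightarrow> 'm list) \<Rightarrow> (nat \<Rightarrow> 'm) set list" where
  "tuple_cls k as = map (\<lambda>j. cls (\<lambda>n. as n ! j)) [0..<k]"

lemma tuple_cls_in:
  assumes "\<And>n. as n \<in> tuples M k"
  shows "tuple_cls k as \<in> tuples upow k"
proof -
  have "(\<lambda>n. as n ! j) \<in> seqs" if "j < k" for j
    unfolding seqs_def
  proof (intro CollectI allI)
    fix n
    have "as n ! j \<in> set (as n)" using that assms[of n] by (auto simp: tuples_def)
    then show "as n ! j \<in> univ M" using assms[of n] by (auto simp: tuples_def)
  qed
  then show ?thesis unfolding tuple_cls_def tuples_def univ_upow by auto
qed

lemma pval_upow: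
  assumes \<phi>: "partitioned_form L xs ys \<phi>"
    and as: "\<And>n. as n \<in> tuples M (length xs)" and bs: "\<And>n. bs n \<in> tuples M (length ys)"
  shows "((\<lambda>n. pval M xs ys \<phi> (as n) (bs n)) \<longlongrightarrow>
    pval upow xs ys \<phi> (tuple_cls (length xs) as) (tuple_cls (length ys) bs)) U"
proof -
  obtain e where e: "e \<in> univ M" using struct unfolding is_structure_def by blast
  let ?zs = "xs @ ys"
  have dist: "distinct ?zs" using \<phi> unfolding partitioned_form_def by simp
  \<comment> \<open>The default \<open>e\<close> keeps every variable inside the universe of
    \<open>M\<close>, since \<open>Los\<close> needs all the \<open>w x\<close> in
    \<open>seqs\<close>.\<close>
  define w where "w x n = (case map_of (zip ?zs (as n @ bs n)) x of None \<Rightarrow> e | Some c \<Rightarrow> c)" for x :: nat and n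
  have len: "length (as n) = length xs" "length (bs n) = length ys" for n using as bs unfolding tuples_def by auto
  have sub: "set (as n @ bs n) \<subseteq> univ M" for n using as[of n] bs[of n] unfolding tuples_def by auto
  have w_nth: "w (?zs ! i) n = (as n @ bs n) ! i" if "i < length ?zs" for i n
    unfolding w_def using that len dist by (subst map_of_zip_nth) auto
  have "w x n \<in> univ M" for x n
    unfolding w_def using sub[of n] e map_of_SomeD[of "zip ?zs (as n @ bs n)" x] set_zip_rightD
    by (force split: option.split)
  then have w: "w x \<in> seqs" for x unfolding seqs_def by simp
  have "pval M xs ys \<phi> (as n) (bs n) = fval M (\<lambda>x. w x n) \<phi>" for n
    using len w_nth by (intro pval_eq_fval[OF \<phi>]) auto
  moreover have "pval upow xs ys \<phi> (tuple_cls (length xs) as) (tuple_cls (length ys) bs) = fval upow (\<lambda>x. cls (w x)) \<phi>"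
  proof (rule pval_eq_fval[OF \<phi>])
    fix i assume i: "i < length ?zs"
    have "w (?zs ! i) = (\<lambda>n. (as n @ bs n) ! i)" using w_nth[OF i] by blast
    then show "cls (w (?zs ! i)) = (tuple_cls (length xs) as @ tuple_cls (length ys) bs) ! i"
      using i len by (auto simp: tuple_cls_def nth_append)
  qed (auto simp: tuple_cls_def)
  moreover have "wf_form L \<phi>" using \<phi> unfolding partitioned_form_def by simp
  ultimately show ?thesis using Los[of w, OF w] by simp
qed

end

section \<open>From NIP to averages\<close>

lemma pval_bounds:
  assumes M: "is_structure L M" and \<phi>: "partitioned_form L xs ys \<phi>"
    and a: "a \<in> tuples M (length xs)" and b: "b \<in> tuples M (length ys)"
  shows "pval M xs ys \<phi> a b \<in> {0..1}"
proof -
  obtain e where e: "e \<in> univ M" using M unfolding is_structure_def by blast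
  let ?zs = "xs @ ys"
  define v where "v x = (case map_of (zip ?zs (a @ b)) x of None \<Rightarrow> e | Some c \<Rightarrow> c)" for x
  have "v x \<in> univ M" for x
  proof (cases "map_of (zip ?zs (a @ b)) x")
    case (Some c)
    then have "c \<in> set (a @ b)" by (meson map_of_SomeD set_zip_rightD)
    then show ?thesis using Some a b unfolding v_def tuples_def by auto
  qed (use e in \<open>simp add: v_def\<close>)
  moreover have "pval M xs ys \<phi> a b = fval M v \<phi>"
  proof (rule pval_eq_fval[OF \<phi>])
    fix i assume "i < length ?zs"
    then show "v (?zs ! i) = (a @ b) ! i"
      unfolding v_def using a b \<phi> by (subst map_of_zip_nth) (auto simp: tuples_def partitioned_form_def)
  qed (use a b in \<open>auto simp: tuples_def\<close>)
  ultimately show ?thesis using fval_bounds[OF M, of \<phi> v] \<phi> unfolding partitioned_form_def by auto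
qed

lemma gap_NIP_of_NIP:
  fixes M :: "('f, 'p, 'm) cstructure"
  assumes wf: "wf_signature L" and T: "T \<subseteq> sentences L" and nip: "NIP TYPE((nat \<Rightarrow> 'm) set) L T"
    and M: "models L M T" and \<phi>: "partitioned_form L xs ys \<phi>"
  shows "gap_NIP (pval M xs ys \<phi>) (tuples M (length xs)) (tuples M (length ys))"
proof (rule ccontr)
  let ?X = "tuples M (length xs)" and ?Y = "tuples M (length ys)"
  assume "\<not> ?thesis"
  then obtain r s where rs: "r < s"
    and "\<forall>d. \<exists>a. (\<forall>i<d. a i \<in> ?X) \<and> gap_shatters (pval M xs ys \<phi>) ?Y r s a {..<d::nat}"
    unfolding gap_NIP_def by auto
  then obtain a where a: "\<And>d i. i < d \<Longrightarrow> a d i \<in> ?X"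
    and sh: "\<And>d. gap_shatters (pval M xs ys \<phi>) ?Y r s (a d) {..<d::nat}"
    by metis
  have struct: "is_structure L M" using M unfolding models_def by simp
  obtain e where e: "e \<in> univ M" using struct unfolding is_structure_def by blast
  \<comment> \<open>The \<open>d\<close>-th shattered sequence has only \<open>d\<close> members.
    Padding for \<open>d \<le> i\<close> affects finitely many \<open>d\<close> for each
    \<open>i\<close>, and a free ultrafilter ignores them.\<close>
  define a' where "a' i d = (if i < d then a d i else replicate (length xs) e)" for i d
  have a': "a' i d \<in> ?X" for i d using a e unfolding a'_def by (auto simp: tuples_def)
  obtain U :: "nat filter" where U: "is_ultrafilter U" "U \<le> sequentially"
    using ex_ultrafilter_le[OF sequentially_bot] by blast
  interpret ultrapower U L M using U wf struct by unfold_locales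
  let ?a = "\<lambda>i. tuple_cls (length xs) (a' i)"
  have late: "eventually (\<lambda>n. i < n) U" for i :: nat using U(2) eventually_gt_at_top[of i] by (rule filter_leD)
  have "\<exists>b\<in>tuples upow (length ys).
      (\<forall>i\<in>I. pval upow xs ys \<phi> (?a i) b \<le> r) \<and> (\<forall>i\<in>-I. s \<le> pval upow xs ys \<phi> (?a i) b)" for I :: "nat set"
  proof -
    \<comment> \<open>The infinite pattern \<open>I\<close> is realized on its initial segment of
      length \<open>n\<close> for each \<open>n\<close>; the class of these parameters realizes all
      of \<open>I\<close>.\<close>
    have "\<exists>b\<in>?Y. (\<forall>i\<in>I \<inter> {..<n}. pval M xs ys \<phi> (a n i) b \<le> r) \<and>
        (\<forall>i\<in>{..<n} - I \<inter> {..<n}. s \<le> pval M xs ys \<phi> (a n i) b)" for n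
      using sh[of n] unfolding gap_shatters_def by (meson Int_lower2)
    then obtain b where b: "\<And>n. b n \<in> ?Y"
      and lo: "\<And>n i. i \<in> I \<Longrightarrow> i < n \<Longrightarrow> pval M xs ys \<phi> (a n i) (b n) \<le> r"
      and hi: "\<And>n i. i \<notin> I \<Longrightarrow> i < n \<Longrightarrow> s \<le> pval M xs ys \<phi> (a n i) (b n)"
      by (metis DiffI IntD1 IntI lessThan_iff)
    let ?b = "tuple_cls (length ys) b"
    note lim = pval_upow[OF \<phi> a' b]
    have "pval upow xs ys \<phi> (?a i) ?b \<le> r" if "i \<in> I" for i
    proof (rule tendsto_upperbound[OF lim _ U_nonbot])
      show "eventually (\<lambda>n. pval M xs ys \<phi> (a' i n) (b n) \<le> r) U"
        using late[of i] by eventually_elim (use lo that in \<open>simp add: a'_def\<close>)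
    qed
    moreover have "s \<le> pval upow xs ys \<phi> (?a i) ?b" if "i \<notin> I" for i
    proof (rule tendsto_lowerbound[OF lim _ U_nonbot])
      show "eventually (\<lambda>n. s \<le> pval M xs ys \<phi> (a' i n) (b n)) U"
        using late[of i] by eventually_elim (use hi that in \<open>simp add: a'_def\<close>)
    qed
    ultimately show ?thesis using tuple_cls_in[of b, OF b] by blast
  qed
  note ip = this
  have a_in: "?a i \<in> tuples upow (length xs)" for i using a' by (rule tuple_cls_in)
  \<comment> \<open>\<open>gap_NIP\<close> allows any \<open>r < s\<close>, but
    \<open>has_IP\<close> asks for \<open>s \<le> 1\<close>. The empty pattern provides this: some
    value is at least \<open>s\<close>, and all values are at most 1.\<close>
  obtain b where "b \<in> tuples upow (length ys)" "s \<le> pval upow xs ys \<phi> (?a 0) b"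
    using ip[of "{}"] by auto
  moreover from this have "pval upow xs ys \<phi> (?a 0) b \<le> 1"
    using pval_bounds[OF is_structure_upow \<phi> a_in] by auto
  ultimately have "s \<le> 1" by simp
  then have "has_IP TYPE((nat \<Rightarrow> 'm) set) L T xs ys \<phi>"
    unfolding has_IP_def using models_upow[OF M T] rs ip a_in
    by (intro exI[of _ upow] conjI exI[of _ r] exI[of _ s] exI[of _ ?a]) auto
  then show False using nip \<phi> unfolding NIP_def by blast
qed

theorem theorem4p5:
  fixes L :: "('f, 'p) signature"
    and T :: "('f, 'p) cform set"
    and M :: "('f, 'p, 'm) cstructure"
    and \<Omega> :: "'w set" and \<B> :: "'w set set" and m :: "'w set \<Rightarrow> real"
    and R :: "('w \<Rightarrow> 'm) set"
    and \<phi> :: "('f, 'p) cform" and xs ys :: "nat list" and r s :: real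
  assumes "wf_signature L"
    and "complete_theory TYPE('n) L T"
    and "NIP TYPE((nat \<Rightarrow> 'm) set) L T"
    and "models L M T"
    and "atomless_fa_prob_space \<Omega> \<B> m"
    and "R = simple_randomization \<Omega> \<B> M"
    and "partitioned_form L xs ys \<phi>"
    and "r < s"
  shows "\<exists>N::nat. \<not> (\<exists>\<mu>. (\<forall>i<N. average_measure M xs (\<mu> i)) \<and>
                        shattered_by_simple M \<phi> ys r s N \<mu>)"
proof -
  let ?X = "tuples M (length xs)" and ?Y = "tuples M (length ys)"
  have T: "T \<subseteq> sentences L" using assms(2) unfolding complete_theory_def Th_def by auto
  have struct: "is_structure L M" using assms(4) unfolding models_def by simp
  have "\<exists>n::nat. \<forall>as. (\<forall>i<n. as i \<noteq> [] \<and> set (as i) \<subseteq> ?X) \<longrightarrow>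
    \<not> gap_shatters
        (\<lambda>as bs. (\<Sum>b\<leftarrow>bs. (\<Sum>a\<leftarrow>as. pval M xs ys \<phi> a b) / real (length as)) / real (length bs))
        {bs. bs \<noteq> [] \<and> set bs \<subseteq> ?Y} r s as {..<n}"
  proof (rule gap_NIP_averages[OF _ gap_NIP_of_NIP[OF assms(1) T assms(3,4,7)] assms(8)])
    show "pval M xs ys \<phi> a b \<in> {0..1}" if "a \<in> ?X" "b \<in> ?Y" for a b
      using that by (rule pval_bounds[OF struct assms(7)])
  qed
  then obtain n :: nat where n: "\<forall>as. (\<forall>i<n. as i \<noteq> [] \<and> set (as i) \<subseteq> ?X) \<longrightarrow>
    \<not> gap_shatters
        (\<lambda>as bs. (\<Sum>b\<leftarrow>bs. (\<Sum>a\<leftarrow>as. pval M xs ys \<phi> a b) / real (length as)) / real (length bs))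
        {bs. bs \<noteq> [] \<and> set bs \<subseteq> ?Y} r s as {..<n}"
    by (rule exE)
  have False if \<mu>: "\<forall>i<n. average_measure M xs (\<mu> i)" and sh: "shattered_by_simple M \<phi> ys r s n \<mu>" for \<mu>
  proof -
    obtain as where as: "\<And>i. i < n \<Longrightarrow> as i \<noteq> []" "\<And>i. i < n \<Longrightarrow> set (as i) \<subseteq> ?X"
        "\<And>i. i < n \<Longrightarrow> \<mu> i = Ave M xs (as i)"
      using \<mu> unfolding average_measure_def by metis
    have "gap_shatters
        (\<lambda>as bs. (\<Sum>b\<leftarrow>bs. (\<Sum>a\<leftarrow>as. pval M xs ys \<phi> a b) / real (length as)) / real (length bs))
        {bs. bs \<noteq> [] \<and> set bs \<subseteq> ?Y} r s as {..<n}"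
      unfolding gap_shatters_def
    proof (intro allI impI)
      fix I assume I: "I \<subseteq> {..<n}"
      then obtain bs where bs: "bs \<noteq> []" "set bs \<subseteq> ?Y"
        "\<forall>i\<in>I. (\<Sum>b\<leftarrow>bs. \<mu> i \<phi> ys b) / real (length bs) \<le> r"
        "\<forall>i\<in>{..<n} - I. s \<le> (\<Sum>b\<leftarrow>bs. \<mu> i \<phi> ys b) / real (length bs)"
        using sh unfolding shattered_by_simple_def by meson
      \<comment> \<open>Only the first \<open>n\<close> entries of \<open>\<mu>\<close> are known to
        be averages, hence the restriction on \<open>i\<close>.\<close>
      have eq: "(\<Sum>b\<leftarrow>bs. \<mu> i \<phi> ys b) = (\<Sum>b\<leftarrow>bs. (\<Sum>a\<leftarrow>as i. pval M xs ys \<phi> a b) / real (length (as i)))"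
        if "i < n" for i using as(3)[OF that] by (simp add: Ave_def)
      show "\<exists>bs\<in>{bs. bs \<noteq> [] \<and> set bs \<subseteq> ?Y}.
          (\<forall>i\<in>I. (\<Sum>b\<leftarrow>bs. (\<Sum>a\<leftarrow>as i. pval M xs ys \<phi> a b) / real (length (as i))) / real (length bs) \<le> r) \<and>
          (\<forall>i\<in>{..<n} - I. s \<le> (\<Sum>b\<leftarrow>bs. (\<Sum>a\<leftarrow>as i. pval M xs ys \<phi> a b) / real (length (as i))) / real (length bs))"
      proof (intro bexI[of _ bs] conjI ballI)
        fix i assume "i \<in> I"
        then show "(\<Sum>b\<leftarrow>bs. (\<Sum>a\<leftarrow>as i. pval M xs ys \<phi> a b) / real (length (as i))) / real (length bs) \<le> r"
          using bs(3) I by (subst eq[symmetric]) auto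
      next
        fix i assume "i \<in> {..<n} - I"
        then show "s \<le> (\<Sum>b\<leftarrow>bs. (\<Sum>a\<leftarrow>as i. pval M xs ys \<phi> a b) / real (length (as i))) / real (length bs)"
          using bs(4) by (subst eq[symmetric]) auto
      qed (use bs in auto)
    qed
    then show False using n as(1,2) by blast
  qed
  then show ?thesis by blast
qed

end
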